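(* Let $D\subset\mathbb{R}^s$ be a convex polyhedral set, let $g:\mathbb{R}^n\to\mathbb{R}^s$ be twice continuously differentiable, let $\Gamma:=\{x\in\mathbb{R}^n: g(x)\in D\}$, let $\bar x\in\Gamma$ and assume that the constraint map $x'\rightrightarrows g(x')-D$ is metrically subregular at $(\bar x,0)$. Then for all $x$ sufficiently near $\bar x$ the following holds: if for some $u\in\mathbb{R}^n$ the non-degeneracy condition \[\nabla g(x)^T\mu=0,\ \ \mu\in\mathrm{sp}\,N_{T_D(g(x))}(\nabla g(x)u)\ \Longrightarrow\ \mu=0\] is satisfied, then the normal cone mapping $x'\rightrightarrows N_\Gamma(x')$ is semismooth* at $(x,x^* )$ in direction $(u,u^* )$ for every $x^*,u^*\in\mathbb{R}^n$, i.e., \[\langle u,w\rangle=\langle u^*,w^*\rangle\qquad\forall\,(w^*,w)\in\mathrm{gph}\,D^*N_\Gamma((x,x^* );(u,u^* )).\]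
   Context: For a closed set $\Omega$ and $\bar z\in\Omega$: $T_\Omega(\bar z)=\{w:\exists t_k\downarrow0,\,w_k\to w,\ \bar z+t_kw_k\in\Omega\ \forall k\}$; $\widehat N_\Omega(\bar z)=T_\Omega(\bar z)^\circ$ (negative polar); limiting normal cone $N_\Omega(\bar z)=\{z^*:\exists z_k\to\bar z,\ z_k^*\to z^*,\ z_k^*\in\widehat N_\Omega(z_k)\}$ (the usual normal cone if $\Omega$ is convex); directional limiting normal cone $N_\Omega(\bar z;w)=\{z^*:\exists t_k\downarrow0,\ w_k\to w,\ z_k^*\to z^*,\ z_k^*\in\widehat N_\Omega(\bar z+t_kw_k)\}$. All are empty at points outside $\Omega$. $\mathrm{sp}\,A$ is the linear hull of $A$, with $\mathrm{sp}\,\emptyset=\{0\}$. A convex polyhedral set is a finite intersection of halfspaces. Directional limiting coderivative: $D^*M((\bar x,\bar y);(u,v))(v^* )=\{u^*:(u^*,-v^* )\in N_{\mathrm{gph}\,M}((\bar x,\bar y);(u,v))\}$ (empty if $(\bar x,\bar y)\notin\mathrm{gph}\,M$). $M$ is metrically subregular at $(\bar x,\bar y)\in\mathrm{gph}\,M$ if there are $\kappa>0$ and a neighbourhood $U$ of $\bar x$ with $\mathrm{dist}(x,M^{-1}(\bar y))\le\kappa\,\mathrm{dist}(\bar y,M(x))$ for all $x\in U$. *)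

theory Defs
  imports "HOL-Analysis.Analysis"
begin

definition negative_polar :: "'a::euclidean_space set \<Rightarrow> 'a set" where
  "negative_polar A = {z. \<forall>w\<in>A. z \<bullet> w \<le> 0}"

text \<open>All cones below are empty at points outside \<open>\<Omega>\<close>, so membership of the base point
  is part of each definition. The limit \<open>t \<down> 0\<close> is read as \<open>t k > 0\<close> and \<open>t \<longlonglongrightarrow> 0\<close>.\<close>

definition tangent_cone :: "'a::euclidean_space set \<Rightarrow> 'a \<Rightarrow> 'a set" where
  "tangent_cone \<Omega> z = {w. z \<in> \<Omega> \<and>
     (\<exists>(t :: nat \<Rightarrow> real) ws. (\<forall>k. t k > 0) \<and> t \<longlonglongrightarrow> 0 \<and> ws \<longlonglongrightarrow> w \<and>
        (\<forall>k. z + t k *\<^sub>R ws k \<in> \<Omega>))}"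

text \<open>The explicit guard is needed here: the polar of the empty set is the whole space.\<close>

definition regular_normal_cone :: "'a::euclidean_space set \<Rightarrow> 'a \<Rightarrow> 'a set" where
  "regular_normal_cone \<Omega> z = (if z \<in> \<Omega> then negative_polar (tangent_cone \<Omega> z) else {})"

definition limiting_normal_cone :: "'a::euclidean_space set \<Rightarrow> 'a \<Rightarrow> 'a set" where
  "limiting_normal_cone \<Omega> z = {zs. z \<in> \<Omega> \<and>
     (\<exists>(zk :: nat \<Rightarrow> 'a) zsk. zk \<longlonglongrightarrow> z \<and> zsk \<longlonglongrightarrow> zs \<and>
        (\<forall>k. zsk k \<in> regular_normal_cone \<Omega> (zk k)))}"

definition directional_normal_cone :: "'a::euclidean_space set \<Rightarrow> 'a \<Rightarrow> 'a \<Rightarrow> 'a set" where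
  "directional_normal_cone \<Omega> z w = {zs. z \<in> \<Omega> \<and>
     (\<exists>(t :: nat \<Rightarrow> real) ws zsk. (\<forall>k. t k > 0) \<and> t \<longlonglongrightarrow> 0 \<and> ws \<longlonglongrightarrow> w \<and> zsk \<longlonglongrightarrow> zs \<and>
        (\<forall>k. zsk k \<in> regular_normal_cone \<Omega> (z + t k *\<^sub>R ws k)))}"

text \<open>A set-valued mapping is a function into sets; its graph lives in the product space, which
  carries the sum inner product.\<close>

definition gph :: "('a \<Rightarrow> 'b set) \<Rightarrow> ('a \<times> 'b) set" where
  "gph M = {(x, y). y \<in> M x}"

definition directional_coderivative ::
  "('a::euclidean_space \<Rightarrow> 'b::euclidean_space set) \<Rightarrow> 'a \<times> 'b \<Rightarrow> 'a \<times> 'b \<Rightarrow> 'b \<Rightarrow> 'a set" where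
  "directional_coderivative M p d vs = {us. (us, - vs) \<in> directional_normal_cone (gph M) p d}"

definition semismooth_star_in_direction ::
  "('a::euclidean_space \<Rightarrow> 'b::euclidean_space set) \<Rightarrow> 'a \<times> 'b \<Rightarrow> 'a \<times> 'b \<Rightarrow> bool" where
  "semismooth_star_in_direction M p d \<longleftrightarrow>
     (\<forall>(vs, us) \<in> gph (directional_coderivative M p d). fst d \<bullet> us = snd d \<bullet> vs)"

text \<open>Since \<open>infdist y {} = 0\<close> while the distance to the empty set is \<open>\<infinity>\<close>, points with \<open>M x = {}\<close>
  satisfy the estimate trivially and are excluded. The set \<open>{x'. y \<in> M x'}\<close> is the inverse image
  of \<open>y\<close>; it contains the reference point, hence is nonempty.\<close>

definition metrically_subregular_at ::
  "('a::metric_space \<Rightarrow> 'b::metric_space set) \<Rightarrow> 'a \<Rightarrow> 'b \<Rightarrow> bool" where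
  "metrically_subregular_at M xbar y \<longleftrightarrow> (xbar, y) \<in> gph M \<and>
     (\<exists>\<kappa>>0. \<forall>\<^sub>F x in nhds xbar. M x \<noteq> {} \<longrightarrow>
        infdist x {x'. y \<in> M x'} \<le> \<kappa> * infdist y (M x))"

definition twice_continuously_differentiable ::
  "('a::real_normed_vector \<Rightarrow> 'b::real_normed_vector) \<Rightarrow> bool" where
  "twice_continuously_differentiable g \<longleftrightarrow>
     (\<exists>(g' :: 'a \<Rightarrow> 'a \<Rightarrow>\<^sub>L 'b) (g'' :: 'a \<Rightarrow> 'a \<Rightarrow>\<^sub>L 'a \<Rightarrow>\<^sub>L 'b).
        (\<forall>x. (g has_derivative blinfun_apply (g' x)) (at x)) \<and>
        (\<forall>x. (g' has_derivative blinfun_apply (g'' x)) (at x)) \<and>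
        continuous_on UNIV g'')"

end

theory Submission
  imports Defs
begin

text \<open>
  Write \<open>N\<close> for the normal cone mapping of \<open>\<Gamma>\<close>, and let \<open>(ws, - vs)\<close> be a limiting normal to its
  graph at \<open>(x, xs)\<close> in direction \<open>(u, us)\<close>: a limit of regular normals at graph points
  \<open>(z k, q k) = (x, xs) + t k (d k)\<close> with \<open>d k \<longlonglongrightarrow> (u, us)\<close>. The claim
  \<open>u \<bullet> ws = us \<bullet> vs\<close> says that this limit is orthogonal to \<open>(u, us)\<close>. A regular normal is orthogonal
  to every tangent whose negative is also a tangent, so it suffices to find two-sided tangents to
  the graph at \<open>(z k, q k)\<close> that converge to \<open>(u, us)\<close>.

  Metric subregularity is an error bound on a whole neighbourhood of the reference point. There it
  makes the linearised cone a subset of the tangent cone, and Farkas' lemma represents regular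
  normals as \<open>g'(z)\<^sup>* m\<close> with a multiplier \<open>m\<close> normal to \<open>D\<close> at \<open>g z\<close>
  (\<open>regular_normal_cone_constraint_set\<close>). A polyhedron has finitely many normal cones, so one may
  assume that the cone at \<open>g (z k)\<close> is a fixed \<open>K\<close>. Since the points \<open>z k\<close> approach \<open>x\<close> in direction
  \<open>u\<close>, this \<open>K\<close> lies in the normal cone that occurs in the non-degeneracy condition
  (\<open>polyhedral_normals_in_directional_cone\<close>). Hence \<open>g'(x)\<^sup>*\<close> is injective on \<open>span K\<close>, and so
  are the nearby \<open>g'(z)\<^sup>*\<close>, uniformly. Three things follow. Limiting normals at \<open>z k\<close> have
  multipliers in \<open>K\<close>; the multipliers \<open>m k\<close> of \<open>q k\<close> converge to a multiplier \<open>l\<close> of \<open>xs\<close>, and the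
  quotients \<open>(m k - l) / t k\<close> converge too (\<open>blinfun_adjoint_multipliers_converge\<close>); and the inverse
  function theorem straightens the functions \<open>n \<bullet> g\<close>, \<open>n \<in> K\<close>, near \<open>x\<close>
  (\<open>constraint_set_straightening\<close>).

  The straightening yields curves through \<open>z k\<close>, with velocities converging to \<open>u\<close>, along which
  \<open>g\<close> stays on one face of \<open>D\<close>. Polyhedrality of \<open>K\<close> allows, after another choice of subsequence,
  to move \<open>m k\<close> inside \<open>K\<close> in both directions along the line through \<open>l\<close>
  (\<open>polyhedron_line_extension\<close>). Moving point and multiplier together gives a curve in the graph of
  \<open>N\<close> that can be traversed both ways (\<open>normal_orthogonal_to_two_sided_tangent\<close>), and its velocity
  converges to \<open>(u, us)\<close>: the derivative of \<open>z \<mapsto> g'(z)\<^sup>* m\<close> is continuous in \<open>z\<close> and \<open>m\<close>, and the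
  limit has to satisfy the same product rule as the quotients \<open>(q k - xs) / t k\<close>.
\<close>

section \<open>Adjoints of continuous linear maps and multipliers\<close>

text \<open>The formula expands the adjoint in the standard basis. Unlike \<open>adjoint\<close>, it is visibly linear
  in \<open>T\<close> as well as in \<open>n\<close>, so it can be differentiated when \<open>T\<close> varies with the base point.\<close>

definition blinfun_adjoint :: "('a::euclidean_space \<Rightarrow>\<^sub>L 'b::euclidean_space) \<Rightarrow> 'b \<Rightarrow> 'a" where
  "blinfun_adjoint T n = (\<Sum>b\<in>Basis. (n \<bullet> T b) *\<^sub>R b)"

lemma blinfun_adjoint_inner: "blinfun_adjoint T n \<bullet> h = n \<bullet> T h"
proof -
  have "T h = T (\<Sum>b\<in>Basis. (h \<bullet> b) *\<^sub>R b)"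
    by (simp add: euclidean_representation)
  also have "\<dots> = (\<Sum>b\<in>Basis. (h \<bullet> b) *\<^sub>R T b)"
    by (simp add: blinfun.sum_right blinfun.scaleR_right)
  finally show ?thesis
    by (simp add: blinfun_adjoint_def inner_sum_left inner_sum_right inner_commute mult.commute)
qed

lemma bounded_bilinear_blinfun_adjoint:
  "bounded_bilinear (blinfun_adjoint :: ('a::euclidean_space \<Rightarrow>\<^sub>L 'b::euclidean_space) \<Rightarrow> _)"
proof -
  have norm: "norm (blinfun_adjoint T n) \<le> norm T * norm n"
    for T :: "'a \<Rightarrow>\<^sub>L 'b" and n
  proof (cases "blinfun_adjoint T n = 0")
    case False
    have "norm (blinfun_adjoint T n) * norm (blinfun_adjoint T n) = n \<bullet> T (blinfun_adjoint T n)"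
      by (metis blinfun_adjoint_inner power2_eq_square power2_norm_eq_inner)
    also have "\<dots> \<le> norm n * norm (T (blinfun_adjoint T n))"
      by (rule norm_cauchy_schwarz)
    also have "\<dots> \<le> norm n * (norm T * norm (blinfun_adjoint T n))"
      by (intro mult_left_mono norm_blinfun) auto
    finally have "norm (blinfun_adjoint T n) * norm (blinfun_adjoint T n)
        \<le> (norm T * norm n) * norm (blinfun_adjoint T n)"
      by (simp add: mult_ac)
    with False show ?thesis by (simp add: mult_le_cancel_right)
  qed simp
  show ?thesis
  proof
    show "\<exists>K. \<forall>(T :: 'a \<Rightarrow>\<^sub>L 'b) n. norm (blinfun_adjoint T n) \<le> norm T * norm n * K"
      using norm by (intro exI[of _ 1]) simp
  qed (auto simp: blinfun_adjoint_def blinfun.bilinear_simps inner_simps algebra_simps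
        sum.distrib scaleR_sum_right)
qed

lemmas blinfun_adjoint_simps = bounded_bilinear.zero_right[OF bounded_bilinear_blinfun_adjoint]
  bounded_bilinear.add_right[OF bounded_bilinear_blinfun_adjoint]
  bounded_bilinear.diff_right[OF bounded_bilinear_blinfun_adjoint]
  bounded_bilinear.scaleR_right[OF bounded_bilinear_blinfun_adjoint]
  bounded_bilinear.add_left[OF bounded_bilinear_blinfun_adjoint]
  bounded_bilinear.diff_left[OF bounded_bilinear_blinfun_adjoint]
  bounded_bilinear.scaleR_left[OF bounded_bilinear_blinfun_adjoint]

lemmas tendsto_blinfun_adjoint =
  bounded_bilinear.tendsto[OF bounded_bilinear_blinfun_adjoint]

lemma linear_blinfun_adjoint: "linear (blinfun_adjoint T)"
  by (intro linearI) (simp_all add: blinfun_adjoint_simps)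

lemma blinfun_adjoint_left_inverse:
  fixes T :: "'a::euclidean_space \<Rightarrow>\<^sub>L 'b::euclidean_space"
  assumes "subspace S" and "\<And>n. n \<in> S \<Longrightarrow> blinfun_adjoint T n = 0 \<Longrightarrow> n = 0"
  obtains h where "bounded_linear h" and "\<And>n. n \<in> S \<Longrightarrow> h (blinfun_adjoint T n) = n"
proof -
  have "inj_on (blinfun_adjoint T) S"
  proof (rule inj_onI)
    fix m n assume "m \<in> S" "n \<in> S" "blinfun_adjoint T m = blinfun_adjoint T n"
    then have "blinfun_adjoint T (m - n) = 0" "m - n \<in> S"
      by (auto simp: blinfun_adjoint_simps subspace_diff assms(1))
    then show "m = n" using assms(2) by fastforce
  qed
  from linear_exists_left_inverse_on[OF linear_blinfun_adjoint assms(1) this]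
  show ?thesis using that by (auto simp: linear_conv_bounded_linear)
qed

text \<open>A left inverse \<open>h\<close> of the adjoint on \<open>S\<close> turns injectivity into the bound
  \<open>norm n \<le> B * norm (T\<^sup>* n)\<close>; moving \<open>T\<close> by so little that the perturbation costs at most half
  of \<open>norm n\<close> keeps the bound, with \<open>2 * B\<close>.\<close>

lemma blinfun_adjoint_uniformly_injective:
  fixes T :: "'a::euclidean_space \<Rightarrow>\<^sub>L 'b::euclidean_space"
  assumes "subspace S" and "\<And>n. n \<in> S \<Longrightarrow> blinfun_adjoint T n = 0 \<Longrightarrow> n = 0"
  obtains C where "C > 0"
    and "\<forall>\<^sub>F T' in nhds T. \<forall>n\<in>S. norm n \<le> C * norm (blinfun_adjoint T' n)"
proof -
  obtain h where h: "bounded_linear h" "\<And>n. n \<in> S \<Longrightarrow> h (blinfun_adjoint T n) = n"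
    using blinfun_adjoint_left_inverse[OF assms] by blast
  obtain B where B: "B > 0" "\<And>x. norm (h x) \<le> norm x * B"
    using bounded_linear.pos_bounded[OF h(1)] by blast
  obtain K where K: "K > 0"
    "\<And>T n. norm (blinfun_adjoint T n :: 'a) \<le> norm (T :: 'a \<Rightarrow>\<^sub>L 'b) * norm n * K"
    using bounded_bilinear.pos_bounded[OF bounded_bilinear_blinfun_adjoint] by blast
  show ?thesis
  proof
    show "2 * B > 0" using B by simp
    have "\<forall>\<^sub>F T' in nhds T. dist T' T < 1 / (2 * B * K)"
      unfolding eventually_nhds_metric using B K by (intro exI[of _ "1 / (2 * B * K)"]) simp
    then show "\<forall>\<^sub>F T' in nhds T. \<forall>n\<in>S. norm n \<le> 2 * B * norm (blinfun_adjoint T' n)"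
    proof (rule eventually_mono, intro ballI)
      fix T' n assume T': "dist T' T < 1 / (2 * B * K)" and "n \<in> S"
      have "norm (blinfun_adjoint (T - T') n) \<le> norm (T - T') * norm n * K"
        by (rule K)
      also have "\<dots> \<le> 1 / (2 * B * K) * norm n * K"
        using T' K by (intro mult_right_mono) (auto simp: dist_norm norm_minus_commute)
      finally have d: "norm (blinfun_adjoint (T - T') n) * B \<le> norm n / 2"
        using B K by (simp add: field_simps)
      have "n = h (blinfun_adjoint T' n + blinfun_adjoint (T - T') n)"
        using h(2)[OF \<open>n \<in> S\<close>] by (simp add: blinfun_adjoint_simps)
      then have "norm n \<le> norm (blinfun_adjoint T' n + blinfun_adjoint (T - T') n) * B"
        using B(2) by metis
      also have "\<dots> \<le> (norm (blinfun_adjoint T' n) + norm (blinfun_adjoint (T - T') n)) * B"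
        using B by (intro mult_right_mono norm_triangle_ineq) auto
      finally show "norm n \<le> 2 * B * norm (blinfun_adjoint T' n)"
        using d by (simp add: algebra_simps)
    qed
  qed
qed

text \<open>Multipliers in a subspace on which the limiting adjoint is injective are determined by their
  images. The uniform bound makes them bounded, hence replacing \<open>Tj\<close> by \<open>T\<close> changes the images by a
  null sequence, and a left inverse of the limiting adjoint then carries the limit over.\<close>

lemma blinfun_adjoint_multipliers_converge:
  fixes T :: "'a::euclidean_space \<Rightarrow>\<^sub>L 'b::euclidean_space"
  assumes S: "subspace S" and inj: "\<And>n. n \<in> S \<Longrightarrow> blinfun_adjoint T n = 0 \<Longrightarrow> n = 0"
    and Tj: "Tj \<longlonglongrightarrow> T" and mS: "\<forall>\<^sub>F j in sequentially. m j \<in> S"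
    and lim: "(\<lambda>j. blinfun_adjoint (Tj j) (m j)) \<longlonglongrightarrow> q"
  obtains n where "n \<in> S" and "m \<longlonglongrightarrow> n" and "blinfun_adjoint T n = q"
proof -
  obtain h where h: "bounded_linear h" "\<And>n. n \<in> S \<Longrightarrow> h (blinfun_adjoint T n) = n"
    using blinfun_adjoint_left_inverse[OF S inj] by blast
  obtain C where C: "C > 0"
    "\<forall>\<^sub>F T' in nhds T. \<forall>n\<in>S. norm n \<le> C * norm (blinfun_adjoint T' n)"
    using blinfun_adjoint_uniformly_injective[OF S inj] by blast
  obtain b where b: "\<And>j. norm (blinfun_adjoint (Tj j) (m j)) \<le> b"
    using convergent_imp_Bseq[OF convergentI[OF lim]] by (auto simp: Bseq_def)
  have "\<forall>\<^sub>F j in sequentially. norm (m j) \<le> C * b"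
    using eventually_compose_filterlim[OF C(2) Tj] mS
  proof eventually_elim
    case (elim j)
    then have "norm (m j) \<le> C * norm (blinfun_adjoint (Tj j) (m j))" by blast
    also have "\<dots> \<le> C * b" using C(1) b by (intro mult_left_mono) auto
    finally show ?case .
  qed
  then have bdd: "Bfun m sequentially" by (rule BfunI)
  have "Zfun (\<lambda>j. T - Tj j) sequentially"
    using tendsto_diff[OF tendsto_const Tj, of T] by (simp add: tendsto_Zfun_iff)
  then have "Zfun (\<lambda>j. blinfun_adjoint (T - Tj j) (m j)) sequentially"
    using bounded_bilinear.Zfun_prod_Bfun[OF bounded_bilinear_blinfun_adjoint _ bdd] by blast
  then have "(\<lambda>j. blinfun_adjoint (T - Tj j) (m j)) \<longlonglongrightarrow> 0"
    by (simp add: tendsto_Zfun_iff)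
  from tendsto_add[OF lim this]
  have lim': "(\<lambda>j. blinfun_adjoint T (m j)) \<longlonglongrightarrow> q"
    by (simp add: blinfun_adjoint_simps)
  have "\<forall>\<^sub>F j in sequentially. h (blinfun_adjoint T (m j)) = m j"
    using mS by eventually_elim (simp add: h)
  then have m: "m \<longlonglongrightarrow> h q"
    using bounded_linear.tendsto[OF h(1) lim'] by (simp add: filterlim_cong)
  show ?thesis
  proof
    show "h q \<in> S"
      using Lim_in_closed_set[OF closed_subspace[OF S] mS _ m] by simp
    have "(\<lambda>j. blinfun_adjoint T (m j)) \<longlonglongrightarrow> blinfun_adjoint T (h q)"
      by (intro tendsto_blinfun_adjoint tendsto_const m)
    then show "blinfun_adjoint T (h q) = q"
      using lim' LIMSEQ_unique by blast
  qed (rule m)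
qed

section \<open>Subsequences, difference quotients and tangents\<close>

lemma subsequence_with_constant_image:
  fixes f :: "nat \<Rightarrow> 'a"
  assumes "finite (range f)"
  obtains r :: "nat \<Rightarrow> nat" where "strict_mono r" and "\<And>k. f (r k) = f (r 0)"
proof -
  obtain k0 where "infinite {k. f k = f k0}"
    using pigeonhole_infinite[OF infinite_UNIV_nat assms] by auto
  then obtain r :: "nat \<Rightarrow> nat" where "strict_mono r" "\<And>k. r k \<in> {k. f k = f k0}"
    using infinite_enumerate by blast
  then show ?thesis by (intro that[of r]) auto
qed

lemma eventually_subsequence_all:
  assumes "\<forall>\<^sub>F k in sequentially. P k"
  obtains r :: "nat \<Rightarrow> nat" where "strict_mono r" and "\<And>k. P (r k)"
proof -
  obtain N where "\<And>k. k \<ge> N \<Longrightarrow> P k" using assms eventually_sequentially by blast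
  then show ?thesis by (intro that[of "\<lambda>k. k + N"]) (auto simp: strict_mono_def)
qed

text \<open>Differentiability in the sense of Hadamard: the increment direction \<open>w k\<close> may vary with the step.
  An arbitrary filter covers sequences as well as the limit \<open>t \<rightarrow> 0\<close> along a curve.\<close>

lemma difference_quotient_tendsto:
  fixes g :: "'a::real_normed_vector \<Rightarrow> 'b::real_normed_vector"
  assumes g: "(g has_derivative T) (at x)" and t: "(t \<longlongrightarrow> (0::real)) F"
    and nz: "\<forall>\<^sub>F k in F. t k \<noteq> 0" and w: "(w \<longlongrightarrow> w0) F"
  shows "((\<lambda>k. (g (x + t k *\<^sub>R w k) - g x) /\<^sub>R t k) \<longlongrightarrow> T w0) F"
proof -
  have T: "bounded_linear T" using g has_derivative_bounded_linear by blast
  define R where "R k = (g (x + t k *\<^sub>R w k) - g x - T (t k *\<^sub>R w k)) /\<^sub>R t k" for k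
  have xl: "((\<lambda>k. x + t k *\<^sub>R w k) \<longlongrightarrow> x) F"
    by (rule tendsto_eq_intros t w | simp)+
  have "(R \<longlongrightarrow> 0) F"
  proof (rule tendstoI)
    fix e :: real assume "e > 0"
    define M where "M = norm w0 + 1"
    have M: "M > 0" by (simp add: M_def add_nonneg_pos)
    have "e / (2 * M) > 0" using M \<open>e > 0\<close> by simp
    with g[unfolded has_derivative_at_alt] obtain d where d: "d > 0" "\<And>y. norm (y - x) < d \<Longrightarrow>
        norm (g y - g x - T (y - x)) \<le> e / (2 * M) * norm (y - x)"
      by blast
    have "\<forall>\<^sub>F k in F. dist (x + t k *\<^sub>R w k) x < d" using xl d(1) tendstoD by blast
    moreover have "\<forall>\<^sub>F k in F. norm (w k) < M"
      using order_tendstoD(2)[OF tendsto_norm[OF w], of M] by (simp add: M_def)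
    ultimately show "\<forall>\<^sub>F k in F. dist (R k) 0 < e"
      using nz
    proof eventually_elim
      case (elim k)
      have "norm (g (x + t k *\<^sub>R w k) - g x - T (t k *\<^sub>R w k)) \<le> e / (2 * M) * (\<bar>t k\<bar> * norm (w k))"
        using d(2)[of "x + t k *\<^sub>R w k"] elim(1) by (simp add: dist_norm)
      also have "\<dots> \<le> e / (2 * M) * (\<bar>t k\<bar> * M)"
        using elim \<open>e > 0\<close> M by (intro mult_left_mono) auto
      finally have "norm (g (x + t k *\<^sub>R w k) - g x - T (t k *\<^sub>R w k)) \<le> e / 2 * \<bar>t k\<bar>"
        using M by (simp add: field_simps)
      moreover have "norm (R k) = norm (g (x + t k *\<^sub>R w k) - g x - T (t k *\<^sub>R w k)) / \<bar>t k\<bar>"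
        unfolding R_def norm_scaleR by (simp add: divide_inverse mult.commute)
      ultimately have "norm (R k) \<le> e / 2"
        using elim(3) by (simp add: divide_le_eq)
      then show ?case using \<open>e > 0\<close> by simp
    qed
  qed
  from tendsto_add[OF this bounded_linear.tendsto[OF T w]]
  have "((\<lambda>k. R k + T (w k)) \<longlongrightarrow> T w0) F" by simp
  then show ?thesis
  proof (rule Lim_transform_eventually)
    show "\<forall>\<^sub>F k in F. R k + T (w k) = (g (x + t k *\<^sub>R w k) - g x) /\<^sub>R t k"
      using nz by eventually_elim
        (simp add: R_def linear_simps[OF T] scaleR_diff_right)
  qed
qed

lemma tangent_coneI_curve:
  assumes "z \<in> \<Omega>" and c: "\<forall>\<^sub>F s in at_right (0::real). c s \<in> \<Omega>"
    and lim: "((\<lambda>s. (c s - z) /\<^sub>R s) \<longlongrightarrow> w) (at_right 0)"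
  shows "w \<in> tangent_cone \<Omega> z"
proof -
  have "(\<lambda>k. inverse (real (Suc k))) \<longlonglongrightarrow> 0" by (rule LIMSEQ_inverse_real_of_nat)
  then have inv: "filterlim (\<lambda>k. inverse (real (Suc k))) (at_right 0) sequentially"
    by (auto simp: filterlim_at)
  obtain r :: "nat \<Rightarrow> nat" where r: "strict_mono r" "\<And>k. c (inverse (real (Suc (r k)))) \<in> \<Omega>"
    using eventually_subsequence_all[OF eventually_compose_filterlim[OF c inv]]
    by blast
  define t where "t k = inverse (real (Suc (r k)))" for k
  have t: "filterlim t (at_right 0) sequentially"
    unfolding t_def using filterlim_compose[OF inv filterlim_subseq[OF r(1)]] by simp
  show ?thesis
    unfolding tangent_cone_def
  proof (intro CollectI conjI exI allI)
    show "t k > 0" for k by (simp add: t_def)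
    show "t \<longlonglongrightarrow> 0" using t filterlim_at by blast
    show "(\<lambda>k. (c (t k) - z) /\<^sub>R t k) \<longlonglongrightarrow> w" using filterlim_compose[OF lim t] by simp
    show "z + t k *\<^sub>R ((c (t k) - z) /\<^sub>R t k) \<in> \<Omega>" for k
      using r(2)[of k] by (simp add: t_def del: of_nat_Suc)
  qed fact
qed

section \<open>Finitely generated cones and Farkas' lemma\<close>

text \<open>Fourier-Motzkin elimination of \<open>t\<close> from the system \<open>c \<bullet> (y - t s) \<le> 0\<close>, \<open>t \<ge> 0\<close>. A constraint
  with \<open>c \<bullet> s > 0\<close> bounds \<open>t\<close> from below, one with \<open>c \<bullet> s < 0\<close> bounds it from above; a suitable
  \<open>t\<close> exists iff each lower bound, including \<open>0\<close>, is below each upper bound.\<close>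

lemma conic_halfspaces_plus_ray:
  fixes s :: "'a::euclidean_space"
  assumes "finite H"
  obtains H' where "finite H'"
    and "{x + t *\<^sub>R s | x t. (\<forall>c\<in>H. c \<bullet> x \<le> 0) \<and> t \<ge> 0} = {x. \<forall>c\<in>H'. c \<bullet> x \<le> 0}"
proof
  define P where "P = {c\<in>H. c \<bullet> s > 0}"
  define N where "N = {c\<in>H. c \<bullet> s \<le> 0}"
  define N' where "N' = {c\<in>H. c \<bullet> s < 0}"
  define H' where "H' = N \<union> (\<lambda>(c, d). c /\<^sub>R (c \<bullet> s) - d /\<^sub>R (d \<bullet> s)) ` (P \<times> N')"
  show "finite H'" using assms by (simp add: H'_def N_def P_def N'_def)
  show "{x + t *\<^sub>R s | x t. (\<forall>c\<in>H. c \<bullet> x \<le> 0) \<and> t \<ge> 0} = {x. \<forall>c\<in>H'. c \<bullet> x \<le> 0}"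
  proof (intro subset_antisym subsetI CollectI ballI)
    fix y c assume y: "y \<in> {x + t *\<^sub>R s | x t. (\<forall>c\<in>H. c \<bullet> x \<le> 0) \<and> t \<ge> 0}" and c: "c \<in> H'"
    from y obtain x t where x: "y = x + t *\<^sub>R s" "\<And>c. c \<in> H \<Longrightarrow> c \<bullet> x \<le> 0" "t \<ge> 0" by blast
    from c consider "c \<in> N"
      | a b where "a \<in> P" "b \<in> N'" "c = a /\<^sub>R (a \<bullet> s) - b /\<^sub>R (b \<bullet> s)"
      by (auto simp: H'_def)
    then show "c \<bullet> y \<le> 0"
    proof cases
      case 1
      then have "c \<bullet> x \<le> 0" "t * (c \<bullet> s) \<le> 0"
        using x by (auto simp: N_def mult_nonneg_nonpos)
      then show ?thesis by (simp add: x(1) inner_add_right)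
    next
      case 2
      have "a \<bullet> s \<noteq> 0" "b \<bullet> s \<noteq> 0" using 2 by (auto simp: P_def N'_def)
      then have "c \<bullet> y = (a \<bullet> x) / (a \<bullet> s) - (b \<bullet> x) / (b \<bullet> s)"
        by (simp add: 2(3) x(1) inner_add_right inner_diff_left) (simp add: field_simps)
      moreover have "(a \<bullet> x) / (a \<bullet> s) \<le> 0" "(b \<bullet> x) / (b \<bullet> s) \<ge> 0"
        using 2 x(2)[of a] x(2)[of b]
        by (auto simp: P_def N'_def divide_nonpos_pos divide_nonpos_neg)
      ultimately show ?thesis by linarith
    qed
  next
    fix y assume "y \<in> {x. \<forall>c\<in>H'. c \<bullet> x \<le> 0}"
    then have y: "\<And>c. c \<in> H' \<Longrightarrow> c \<bullet> y \<le> 0" by blast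
    \<comment> \<open>The smallest \<open>t \<ge> 0\<close> for which \<open>y - t s\<close> satisfies the constraints with \<open>c \<bullet> s > 0\<close>.\<close>
    define t where "t = Max (insert 0 ((\<lambda>c. (c \<bullet> y) / (c \<bullet> s)) ` P))"
    have fin: "finite (insert 0 ((\<lambda>c. (c \<bullet> y) / (c \<bullet> s)) ` P))"
      using assms by (simp add: P_def)
    have t0: "t \<ge> 0" using fin by (simp add: t_def)
    have tP: "(c \<bullet> y) / (c \<bullet> s) \<le> t" if "c \<in> P" for c
      unfolding t_def using fin that by (intro Max_ge) auto
    have "t \<in> insert 0 ((\<lambda>c. (c \<bullet> y) / (c \<bullet> s)) ` P)"
      unfolding t_def using fin by (intro Max_in) auto
    then have tN: "t \<le> (d \<bullet> y) / (d \<bullet> s)" if "d \<in> N'" for d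
    proof (elim insertE imageE)
      assume "t = 0"
      then show ?thesis using y[of d] that by (simp add: H'_def N'_def N_def divide_nonpos_neg)
    next
      fix c assume c: "t = (c \<bullet> y) / (c \<bullet> s)" "c \<in> P"
      then have "c /\<^sub>R (c \<bullet> s) - d /\<^sub>R (d \<bullet> s) \<in> H'"
        using that by (auto simp: H'_def)
      from y[OF this] show ?thesis by (simp add: c inner_diff_left divide_inverse mult.commute)
    qed
    have "c \<bullet> (y - t *\<^sub>R s) \<le> 0" if cH: "c \<in> H" for c
    proof -
      consider "c \<in> P" | "c \<bullet> s = 0" | "c \<in> N'" using cH by (force simp: P_def N'_def)
      then show ?thesis
      proof cases
        case 1 with tP[OF 1] show ?thesis by (simp add: P_def inner_diff_right pos_divide_le_eq)
      next
        case 2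
        then have "c \<in> H'" using cH by (simp add: H'_def N_def)
        with 2 y[of c] show ?thesis by (simp add: inner_diff_right)
      next
        case 3 with tN[OF 3] show ?thesis by (simp add: N'_def inner_diff_right neg_le_divide_eq)
      qed
    qed
    with t0 show "\<exists>x t'. y = x + t' *\<^sub>R s \<and> (\<forall>c\<in>H. c \<bullet> x \<le> 0) \<and> t' \<ge> 0"
      by (intro exI[of _ "y - t *\<^sub>R s"] exI[of _ t]) simp
  qed
qed

text \<open>Half of the Minkowski-Weyl theorem: adding one generator at a time preserves the form of a
  finite system of homogeneous inequalities. Closedness of the cone comes for free.\<close>

lemma finitely_generated_cone_halfspaces:
  fixes S :: "'a::euclidean_space set"
  assumes "finite S"
  obtains H where "finite H" and "convex_cone hull S = {x. \<forall>c\<in>H. c \<bullet> x \<le> 0}"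
proof -
  have "\<exists>H. finite H \<and> convex_cone hull S = {x. \<forall>c\<in>H. c \<bullet> x \<le> 0}"
    using assms
  proof induction
    case empty
    have "x = 0" if "\<forall>c\<in>Basis \<union> uminus ` Basis. c \<bullet> x \<le> 0" for x :: 'a
    proof (rule euclidean_eqI)
      fix b :: 'a assume "b \<in> Basis"
      with that have "b \<bullet> x \<le> 0" "- b \<bullet> x \<le> 0" by blast+
      then show "x \<bullet> b = 0 \<bullet> b" by (simp add: inner_commute)
    qed
    then have "convex_cone hull {} = {x :: 'a. \<forall>c\<in>Basis \<union> uminus ` Basis. c \<bullet> x \<le> 0}"
      by auto
    then show ?case by (intro exI[of _ "Basis \<union> uminus ` Basis"]) simp
  next
    case (insert s S)
    then obtain H where H: "finite H" "convex_cone hull S = {x. \<forall>c\<in>H. c \<bullet> x \<le> 0}" by blast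
    have "convex_cone hull (insert s S)
        = {x + t *\<^sub>R s | x t. x \<in> convex_cone hull S \<and> t \<ge> 0}" (is "?L = ?R")
    proof
      have "convex_cone ?R"
      proof (rule convex_cone_iff[THEN iffD2], intro conjI ballI allI impI)
        have "0 = 0 + 0 *\<^sub>R s" by simp
        then show "0 \<in> ?R" using convex_cone_hull_contains_0[of S] by blast
      next
        fix y z assume "y \<in> ?R" "z \<in> ?R"
        then obtain x t x' t' where "y = x + t *\<^sub>R s" "x \<in> convex_cone hull S" "t \<ge> 0"
          "z = x' + t' *\<^sub>R s" "x' \<in> convex_cone hull S" "t' \<ge> 0" by blast
        then have "y + z = (x + x') + (t + t') *\<^sub>R s" "x + x' \<in> convex_cone hull S" "t + t' \<ge> 0"
          by (auto simp: algebra_simps convex_cone_hull_add)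
        then show "y + z \<in> ?R" by blast
      next
        fix y and c :: real assume "y \<in> ?R" "0 \<le> c"
        then obtain x t where "y = x + t *\<^sub>R s" "x \<in> convex_cone hull S" "t \<ge> 0" by blast
        with \<open>0 \<le> c\<close> have "c *\<^sub>R y = c *\<^sub>R x + (c * t) *\<^sub>R s" "c *\<^sub>R x \<in> convex_cone hull S" "c * t \<ge> 0"
          by (auto simp: algebra_simps convex_cone_hull_mul)
        then show "c *\<^sub>R y \<in> ?R" by blast
      qed
      moreover have "insert s S \<subseteq> ?R"
      proof -
        have "s = 0 + 1 *\<^sub>R s" by simp
        then have "s \<in> ?R" using convex_cone_hull_contains_0[of S] zero_le_one by blast
        moreover have "x \<in> ?R" if "x \<in> S" for x
        proof -
          have "x = x + 0 *\<^sub>R s" by simp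
          then show ?thesis using hull_inc[OF that, of convex_cone] by blast
        qed
        ultimately show ?thesis by blast
      qed
      ultimately show "?L \<subseteq> ?R" by (rule hull_minimal[rotated])
    next
      have "convex_cone hull S \<subseteq> ?L" by (rule hull_mono) auto
      moreover have "s \<in> ?L" by (rule hull_inc) simp
      ultimately show "?R \<subseteq> ?L"
        by (auto intro!: convex_cone_hull_add convex_cone_hull_mul)
    qed
    also have "\<dots> = {x + t *\<^sub>R s | x t. (\<forall>c\<in>H. c \<bullet> x \<le> 0) \<and> t \<ge> 0}"
      by (simp add: H(2))
    finally have eq: "convex_cone hull (insert s S)
        = {x + t *\<^sub>R s | x t. (\<forall>c\<in>H. c \<bullet> x \<le> 0) \<and> t \<ge> 0}" .
    obtain H' where "finite H'"
      "{x + t *\<^sub>R s | x t. (\<forall>c\<in>H. c \<bullet> x \<le> 0) \<and> t \<ge> 0} = {x. \<forall>c\<in>H'. c \<bullet> x \<le> 0}"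
      by (rule conic_halfspaces_plus_ray[OF H(1)])
    with eq show ?case by (intro exI[of _ H']) simp
  qed
  then show ?thesis using that by blast
qed

lemma polyhedron_finitely_generated_cone:
  fixes S :: "'a::euclidean_space set"
  assumes "finite S"
  shows "polyhedron (convex_cone hull S)"
proof -
  obtain H where H: "finite H" "convex_cone hull S = {x. \<forall>c\<in>H. c \<bullet> x \<le> 0}"
    by (rule finitely_generated_cone_halfspaces[OF assms])
  have "{x. \<forall>c\<in>H. c \<bullet> x \<le> 0} = \<Inter> ((\<lambda>c. {x. c \<bullet> x \<le> 0}) ` H)" by auto
  moreover have "polyhedron \<dots>"
    using H(1) by (intro polyhedron_Inter) (auto intro: polyhedron_halfspace_le)
  ultimately show ?thesis by (simp add: H(2))
qed

text \<open>With finitely many halfspaces describing the cone, the normal \<open>c\<close> of a halfspace that excludes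
  \<open>z\<close> would itself be a direction violating the hypothesis.\<close>

lemma farkas:
  fixes S :: "'a::euclidean_space set"
  assumes "finite S" and "\<And>h. (\<And>s. s \<in> S \<Longrightarrow> s \<bullet> h \<le> 0) \<Longrightarrow> z \<bullet> h \<le> 0"
  shows "z \<in> convex_cone hull S"
proof -
  obtain H where H: "finite H" "convex_cone hull S = {x. \<forall>c\<in>H. c \<bullet> x \<le> 0}"
    by (rule finitely_generated_cone_halfspaces[OF assms(1)])
  have "c \<bullet> z \<le> 0" if "c \<in> H" for c
  proof -
    have "s \<bullet> c \<le> 0" if "s \<in> S" for s
      using hull_inc[OF that, of convex_cone] H(2) \<open>c \<in> H\<close> by (auto simp: inner_commute)
    then show ?thesis using assms(2) by (simp add: inner_commute)
  qed
  then show ?thesis by (simp add: H(2))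
qed

section \<open>Local structure of polyhedra\<close>

text \<open>Pairs \<open>(a, b)\<close> are kept, and not just the vectors \<open>a\<close>: the same \<open>a\<close> may occur with several
  right-hand sides, and along a sequence with constant active set the value \<open>a \<bullet> y\<close> has to be
  constant too.\<close>

definition active :: "('a::euclidean_space \<times> real) set \<Rightarrow> 'a \<Rightarrow> ('a \<times> real) set" where
  "active F y = {(a, b)\<in>F. a \<bullet> y = b}"

lemma finite_active: "finite F \<Longrightarrow> finite (active F y)"
  by (rule finite_subset[of _ F]) (auto simp: active_def)

lemma polyhedron_constraints:
  assumes "polyhedron D"
  obtains F where "finite F" and "D = {y. \<forall>(a, b)\<in>F. a \<bullet> y \<le> b}"
proof -
  obtain G where G: "finite G" "D = \<Inter> G" "\<forall>h\<in>G. \<exists>a b. a \<noteq> 0 \<and> h = {x. a \<bullet> x \<le> b}"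
    using assms unfolding polyhedron_def by blast
  have "\<forall>h\<in>G. \<exists>a b. \<forall>x. x \<in> h \<longleftrightarrow> a \<bullet> x \<le> b"
    using G(3) by fast
  then obtain a b where ab: "\<forall>h\<in>G. \<forall>x. x \<in> h \<longleftrightarrow> a h \<bullet> x \<le> b h" by metis
  have "D = {y. \<forall>(c, d)\<in>(\<lambda>h. (a h, b h)) ` G. c \<bullet> y \<le> d}"
    using ab by (auto simp: G(2))
  then show ?thesis using that G(1) by blast
qed

lemma eventually_constraints_active:
  assumes "finite F" and "D = {y. \<forall>(a, b)\<in>F. a \<bullet> y \<le> b}" and "y \<in> D"
  shows "\<forall>\<^sub>F y' in nhds y. active F y' \<subseteq> active F y \<and>
    ((\<forall>(a, b)\<in>active F y. a \<bullet> (y' - y) \<le> 0) \<longrightarrow> y' \<in> D)"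
proof -
  have "\<forall>\<^sub>F y' in nhds y. a \<bullet> y < b \<longrightarrow> a \<bullet> y' < b" for a b
  proof (cases "a \<bullet> y < b")
    case True
    have "((\<lambda>y'. a \<bullet> y') \<longlongrightarrow> a \<bullet> y) (nhds y)" by (intro tendsto_intros filterlim_ident)
    from order_tendstoD(2)[OF this True] show ?thesis by (rule eventually_mono) simp
  qed simp
  then have "\<forall>\<^sub>F y' in nhds y. \<forall>(a, b)\<in>F. a \<bullet> y < b \<longrightarrow> a \<bullet> y' < b"
    using assms(1) by (simp add: eventually_ball_finite case_prod_unfold)
  then show ?thesis
  proof (rule eventually_mono, intro conjI impI)
    fix y' assume *: "\<forall>(a, b)\<in>F. a \<bullet> y < b \<longrightarrow> a \<bullet> y' < b"
    have le: "a \<bullet> y \<le> b" if "(a, b) \<in> F" for a b using assms that by auto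
    show "active F y' \<subseteq> active F y"
      using * le by (force simp: active_def)
    assume act: "\<forall>(a, b)\<in>active F y. a \<bullet> (y' - y) \<le> 0"
    have "a \<bullet> y' \<le> b" if "(a, b) \<in> F" for a b
    proof (cases "a \<bullet> y = b")
      case True
      with that have "(a, b) \<in> active F y" by (auto simp: active_def)
      with act True show ?thesis by (auto simp: inner_diff_right)
    next
      case False
      with le[OF that] * that show ?thesis by force
    qed
    then show "y' \<in> D" by (auto simp: assms(2))
  qed
qed

text \<open>The normal cone of convex analysis; for \<open>y\<close> outside \<open>D\<close> it need not be empty, so membership of
  \<open>y\<close> is always a separate hypothesis.\<close>

definition convex_normals :: "'a::euclidean_space set \<Rightarrow> 'a \<Rightarrow> 'a set" where
  "convex_normals D y = {n. \<forall>d\<in>D. n \<bullet> (d - y) \<le> 0}"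

lemma convex_normals_eq_active_cone:
  assumes F: "finite F" "D = {y. \<forall>(a, b)\<in>F. a \<bullet> y \<le> b}" and y: "y \<in> D"
  shows "convex_normals D y = convex_cone hull (fst ` active F y)"
proof
  show "convex_normals D y \<subseteq> convex_cone hull (fst ` active F y)"
  proof
    fix n assume n: "n \<in> convex_normals D y"
    show "n \<in> convex_cone hull (fst ` active F y)"
    proof (rule farkas[OF finite_imageI[OF finite_active[OF F(1)]]])
      fix h assume h: "\<And>a. a \<in> fst ` active F y \<Longrightarrow> a \<bullet> h \<le> 0"
      have "((\<lambda>t::real. y + t *\<^sub>R h) \<longlongrightarrow> y + 0 *\<^sub>R h) (at_right 0)"
        by (intro tendsto_intros)
      then have "filterlim (\<lambda>t::real. y + t *\<^sub>R h) (nhds y) (at_right 0)" by simp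
      from eventually_compose_filterlim[OF eventually_constraints_active[OF F y] this]
      have "\<forall>\<^sub>F t in at_right (0::real). (\<forall>(a, b)\<in>active F y. a \<bullet> (y + t *\<^sub>R h - y) \<le> 0) \<longrightarrow> y + t *\<^sub>R h \<in> D"
        by (rule eventually_mono) blast
      moreover have "\<forall>\<^sub>F t in at_right (0::real). t > 0" by (rule eventually_at_right_less)
      ultimately have "\<forall>\<^sub>F t in at_right (0::real). t > 0 \<and> y + t *\<^sub>R h \<in> D"
        by eventually_elim (use h in \<open>force simp: mult_le_0_iff\<close>)
      then obtain t :: real where "t > 0" "y + t *\<^sub>R h \<in> D"
        using eventually_happens' trivial_limit_at_right_real by blast
      with n have "n \<bullet> (y + t *\<^sub>R h - y) \<le> 0" unfolding convex_normals_def by blast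
      with \<open>t > 0\<close> show "n \<bullet> h \<le> 0" by (simp add: mult_le_0_iff)
    qed
  qed
next
  have "convex_cone (convex_normals D y)"
    by (auto simp: convex_cone_iff convex_normals_def inner_add_left add_nonpos_nonpos mult_le_0_iff)
  moreover have "fst ` active F y \<subseteq> convex_normals D y"
    by (auto simp: active_def convex_normals_def inner_diff_right F(2))
  ultimately show "convex_cone hull (fst ` active F y) \<subseteq> convex_normals D y"
    by (simp add: hull_minimal)
qed

text \<open>Moving a little away from \<open>y\<close> inside \<open>D\<close> can only deactivate constraints.\<close>

lemma convex_normals_outer_semicontinuous:
  assumes "polyhedron D" and "y \<in> D"
  shows "\<forall>\<^sub>F y' in nhds y. y' \<in> D \<longrightarrow> convex_normals D y' \<subseteq> convex_normals D y"
proof -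
  obtain F where F: "finite F" "D = {y. \<forall>(a, b)\<in>F. a \<bullet> y \<le> b}"
    by (rule polyhedron_constraints[OF assms(1)])
  from eventually_constraints_active[OF F assms(2)] show ?thesis
    by (rule eventually_mono)
      (simp add: convex_normals_eq_active_cone[OF F] assms(2) hull_mono image_mono)
qed

text \<open>A small displacement orthogonal to all normals keeps the active constraints tight and the others
  slack. So the face through \<open>y\<close> can be followed without mentioning a representation of \<open>D\<close>.\<close>

lemma convex_normals_along_face:
  assumes "polyhedron D" and "y \<in> D"
  shows "\<forall>\<^sub>F y' in nhds y. (\<forall>n\<in>convex_normals D y. n \<bullet> (y' - y) = 0) \<longrightarrow>
    y' \<in> D \<and> convex_normals D y \<subseteq> convex_normals D y'"
proof -
  obtain F where F: "finite F" "D = {y. \<forall>(a, b)\<in>F. a \<bullet> y \<le> b}"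
    by (rule polyhedron_constraints[OF assms(1)])
  from eventually_constraints_active[OF F assms(2)] show ?thesis
  proof (rule eventually_mono, intro impI)
    fix y' assume *: "active F y' \<subseteq> active F y \<and>
      ((\<forall>(a, b)\<in>active F y. a \<bullet> (y' - y) \<le> 0) \<longrightarrow> y' \<in> D)"
      and perp: "\<forall>n\<in>convex_normals D y. n \<bullet> (y' - y) = 0"
    have "fst ` active F y \<subseteq> convex_normals D y"
      by (simp add: convex_normals_eq_active_cone[OF F assms(2)] hull_subset)
    with * perp have "y' \<in> D" by force
    moreover have "n \<bullet> (d - y') = n \<bullet> (d - y) - n \<bullet> (y' - y)" for n d
      by (simp add: inner_diff_right)
    ultimately show "y' \<in> D \<and> convex_normals D y \<subseteq> convex_normals D y'"
      using perp by (auto simp: convex_normals_def)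
  qed
qed

lemma polyhedron_convex_normals:
  assumes "polyhedron D" and "y \<in> D"
  shows "polyhedron (convex_normals D y)"
proof -
  obtain F where F: "finite F" "D = {y. \<forall>(a, b)\<in>F. a \<bullet> y \<le> b}"
    by (rule polyhedron_constraints[OF assms(1)])
  show ?thesis
    by (simp add: convex_normals_eq_active_cone[OF F assms(2)] polyhedron_finitely_generated_cone
        finite_active F(1))
qed

lemma finite_range_convex_normals:
  assumes "polyhedron D"
  shows "finite (convex_normals D ` D)"
proof -
  obtain F where F: "finite F" "D = {y. \<forall>(a, b)\<in>F. a \<bullet> y \<le> b}"
    by (rule polyhedron_constraints[OF assms(1)])
  have "convex_normals D ` D \<subseteq> (\<lambda>A. convex_cone hull (fst ` A)) ` Pow F"
    by (force simp: convex_normals_eq_active_cone[OF F] active_def)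
  then show ?thesis by (rule finite_subset) (simp add: F(1))
qed

text \<open>A convergent sequence in a polyhedron has a subsequence that stays in the relative interior of
  one face, that is, keeps one active set. The limit satisfies these constraints with equality, so
  from each member the line through the limit can be continued a little in both directions. This
  is where polyhedrality gives two-sided tangents instead of one-sided ones.\<close>

lemma polyhedron_line_extension:
  fixes z :: "nat \<Rightarrow> 'a::euclidean_space"
  assumes "polyhedron K" and zK: "\<And>k. z k \<in> K" and lim: "z \<longlonglongrightarrow> l"
  obtains r :: "nat \<Rightarrow> nat" where "strict_mono r"
    and "\<And>k. \<forall>\<^sub>F s in nhds 0. z (r k) + s *\<^sub>R (z (r k) - l) \<in> K"
proof -
  obtain F where F: "finite F" "K = {y. \<forall>(a, b)\<in>F. a \<bullet> y \<le> b}"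
    by (rule polyhedron_constraints[OF assms(1)])
  have "finite (range (\<lambda>k. active F (z k)))"
    by (rule finite_subset[of _ "Pow F"]) (auto simp: active_def F(1))
  then obtain r :: "nat \<Rightarrow> nat" where r: "strict_mono r"
      "\<And>k. active F (z (r k)) = active F (z (r 0))"
    using subsequence_with_constant_image by blast
  show ?thesis
  proof (rule that[OF r(1)])
    fix k
    have perp: "a \<bullet> (z (r k) - l) = 0" if a: "(a, b) \<in> active F (z (r k))" for a b
    proof -
      have "(\<lambda>j. a \<bullet> z (r j)) \<longlonglongrightarrow> a \<bullet> l"
        using LIMSEQ_subseq_LIMSEQ[OF lim r(1)] by (intro tendsto_intros) (simp add: o_def)
      moreover have "a \<bullet> z (r j) = b" for j
      proof -
        have "(a, b) \<in> active F (z (r j))" using a r(2)[of j] r(2)[of k] by metis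
        then show ?thesis by (simp add: active_def)
      qed
      ultimately have "a \<bullet> l = b" by (simp add: LIMSEQ_const_iff)
      with a show ?thesis by (simp add: active_def inner_diff_right)
    qed
    have "((\<lambda>s. z (r k) + s *\<^sub>R (z (r k) - l)) \<longlongrightarrow> z (r k) + 0 *\<^sub>R (z (r k) - l)) (nhds 0)"
      by (intro tendsto_intros filterlim_ident)
    then have "filterlim (\<lambda>s. z (r k) + s *\<^sub>R (z (r k) - l)) (nhds (z (r k))) (nhds 0)" by simp
    from eventually_compose_filterlim[OF eventually_constraints_active[OF F zK[of "r k"]] this]
    show "\<forall>\<^sub>F s in nhds 0. z (r k) + s *\<^sub>R (z (r k) - l) \<in> K"
      by (rule eventually_mono) (use perp in auto)
  qed
qed

section \<open>Normals to a smooth preimage of a polyhedron\<close>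

lemma regular_normal_cone_subset_limiting:
  "regular_normal_cone \<Omega> z \<subseteq> limiting_normal_cone \<Omega> z"
proof
  fix n assume n: "n \<in> regular_normal_cone \<Omega> z"
  then have "z \<in> \<Omega>" by (auto simp: regular_normal_cone_def split: if_splits)
  with n show "n \<in> limiting_normal_cone \<Omega> z"
    unfolding limiting_normal_cone_def
    by (intro CollectI conjI exI[of _ "\<lambda>_. z"] exI[of _ "\<lambda>_. n"]) auto
qed

lemma blinfun_adjoint_convex_normals_regular:
  assumes g: "(g has_derivative blinfun_apply T) (at x)" and x: "g x \<in> D"
    and n: "n \<in> convex_normals D (g x)"
  shows "blinfun_adjoint T n \<in> regular_normal_cone {x. g x \<in> D} x"
proof -
  have "n \<bullet> T w \<le> 0" if "w \<in> tangent_cone {x. g x \<in> D} x" for w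
  proof -
    from that obtain t ws where t: "\<And>k. t k > 0" "t \<longlonglongrightarrow> 0" "ws \<longlonglongrightarrow> w"
      "\<And>k. g (x + t k *\<^sub>R ws k) \<in> D"
      by (auto simp: tangent_cone_def)
    have nz: "\<forall>\<^sub>F k in sequentially. t k \<noteq> 0"
      using t(1) by (intro always_eventually) (metis less_irrefl)
    have "(\<lambda>k. n \<bullet> ((g (x + t k *\<^sub>R ws k) - g x) /\<^sub>R t k)) \<longlonglongrightarrow> n \<bullet> T w"
      by (intro tendsto_inner tendsto_const difference_quotient_tendsto[OF g t(2) nz t(3)])
    moreover have "n \<bullet> ((g (x + t k *\<^sub>R ws k) - g x) /\<^sub>R t k) \<le> 0" for k
      using n t(1)[of k] t(4)[of k] by (auto simp: convex_normals_def mult_le_0_iff)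
    ultimately show ?thesis by (intro LIMSEQ_le_const2) auto
  qed
  with x show ?thesis
    by (simp add: regular_normal_cone_def negative_polar_def blinfun_adjoint_inner)
qed

text \<open>The error bound corrects the first-order feasible points \<open>x + t h\<close> by projection onto the
  constraint set; since their infeasibility is \<open>o(t)\<close>, so is the correction, and the projected
  points form a feasible curve with the same initial velocity \<open>h\<close>.\<close>

lemma tangent_cone_constraint_set:
  assumes g: "(g has_derivative blinfun_apply T) (at x)" and x: "g x \<in> D"
    and cl: "closed {x. g x \<in> D}"
    and err: "\<forall>\<^sub>F x' in nhds x. infdist x' {x. g x \<in> D} \<le> \<kappa> * infdist (g x') D"
    and h: "\<forall>\<^sub>F t in at_right 0. g x + t *\<^sub>R T h \<in> D"
  shows "h \<in> tangent_cone {x. g x \<in> D} x"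
proof -
  let ?\<Gamma> = "{x. g x \<in> D}"
  have ne: "?\<Gamma> \<noteq> {}" using x by auto
  have "\<exists>z\<in>?\<Gamma>. infdist (x + t *\<^sub>R h) ?\<Gamma> = dist (x + t *\<^sub>R h) z" for t
    using infdist_attains_inf[OF cl ne] by metis
  then obtain c where c: "\<And>t. c t \<in> ?\<Gamma>"
    "\<And>t. infdist (x + t *\<^sub>R h) ?\<Gamma> = dist (x + t *\<^sub>R h) (c t)" by metis
  have pos: "\<forall>\<^sub>F t in at_right (0::real). t > 0" by (rule eventually_at_right_less)
  have "((\<lambda>t. x + t *\<^sub>R h) \<longlongrightarrow> x + 0 *\<^sub>R h) (at_right 0)" by (intro tendsto_intros)
  then have "filterlim (\<lambda>t. x + t *\<^sub>R h) (nhds x) (at_right 0)" by simp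
  from eventually_compose_filterlim[OF err this]
  have err': "\<forall>\<^sub>F t in at_right 0. dist (x + t *\<^sub>R h) (c t) \<le> \<kappa> * infdist (g (x + t *\<^sub>R h)) D"
    by (simp add: c(2))
  have "((\<lambda>t. (g (x + t *\<^sub>R h) - g x) /\<^sub>R t) \<longlongrightarrow> T h) (at_right 0)"
    using pos by (intro difference_quotient_tendsto[OF g]) (auto elim: eventually_mono)
  then have "((\<lambda>t. \<bar>\<kappa>\<bar> * norm ((g (x + t *\<^sub>R h) - g x) /\<^sub>R t - T h)) \<longlongrightarrow> \<bar>\<kappa>\<bar> * norm (T h - T h)) (at_right 0)"
    by (intro tendsto_intros)
  then have lim0: "((\<lambda>t. \<bar>\<kappa>\<bar> * norm ((g (x + t *\<^sub>R h) - g x) /\<^sub>R t - T h)) \<longlongrightarrow> 0) (at_right 0)"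
    by simp
  have "\<forall>\<^sub>F t in at_right 0. norm ((c t - x) /\<^sub>R t - h) \<le> \<bar>\<kappa>\<bar> * norm ((g (x + t *\<^sub>R h) - g x) /\<^sub>R t - T h)"
    using err' h pos
  proof eventually_elim
    case (elim t)
    have "norm ((c t - x) /\<^sub>R t - h) = norm ((c t - (x + t *\<^sub>R h)) /\<^sub>R t)"
      using elim(3) by (simp add: algebra_simps)
    also have "\<dots> = dist (x + t *\<^sub>R h) (c t) / t"
      using elim(3) by (simp add: dist_norm norm_minus_commute divide_inverse mult.commute)
    also have "\<dots> \<le> \<bar>\<kappa>\<bar> * dist (g (x + t *\<^sub>R h)) (g x + t *\<^sub>R T h) / t"
    proof (intro divide_right_mono)
      have "dist (x + t *\<^sub>R h) (c t) \<le> \<kappa> * infdist (g (x + t *\<^sub>R h)) D" by fact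
      also have "\<dots> \<le> \<bar>\<kappa>\<bar> * infdist (g (x + t *\<^sub>R h)) D"
        by (intro mult_right_mono) (auto simp: infdist_nonneg)
      also have "\<dots> \<le> \<bar>\<kappa>\<bar> * dist (g (x + t *\<^sub>R h)) (g x + t *\<^sub>R T h)"
        by (intro mult_left_mono infdist_le elim) auto
      finally show "dist (x + t *\<^sub>R h) (c t) \<le> \<dots>" .
    qed (use elim in auto)
    also have "\<dots> = \<bar>\<kappa>\<bar> * norm ((g (x + t *\<^sub>R h) - (g x + t *\<^sub>R T h)) /\<^sub>R t)"
      using elim(3) by (simp add: dist_norm divide_inverse mult_ac)
    also have "(g (x + t *\<^sub>R h) - (g x + t *\<^sub>R T h)) /\<^sub>R t = (g (x + t *\<^sub>R h) - g x) /\<^sub>R t - T h"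
      using elim(3) by (simp add: algebra_simps)
    finally show ?case .
  qed
  from Lim_null_comparison[OF this lim0]
  have "((\<lambda>t. (c t - x) /\<^sub>R t) \<longlongrightarrow> h) (at_right 0)"
    by (simp add: LIM_zero_iff)
  then show ?thesis
    using x c(1) by (intro tangent_coneI_curve[where c = c]) auto
qed

text \<open>The multiplier rule: under the error bound the tangent cone contains the linearised cone, and
  Farkas' lemma computes the polar of the latter.\<close>

lemma regular_normal_cone_constraint_set:
  assumes D: "polyhedron D"
    and g: "(g has_derivative blinfun_apply T) (at x)"
    and cl: "closed {x. g x \<in> D}"
    and err: "\<forall>\<^sub>F x' in nhds x. infdist x' {x. g x \<in> D} \<le> \<kappa> * infdist (g x') D"
  shows "regular_normal_cone {x. g x \<in> D} x \<subseteq> blinfun_adjoint T ` convex_normals D (g x)"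
proof
  fix xs assume xs: "xs \<in> regular_normal_cone {x. g x \<in> D} x"
  then have x: "g x \<in> D" and polar: "\<And>w. w \<in> tangent_cone {x. g x \<in> D} x \<Longrightarrow> xs \<bullet> w \<le> 0"
    by (auto simp: regular_normal_cone_def negative_polar_def split: if_splits)
  obtain F where F: "finite F" "D = {y. \<forall>(a, b)\<in>F. a \<bullet> y \<le> b}"
    by (rule polyhedron_constraints[OF D])
  let ?A = "fst ` active F (g x)"
  have "xs \<in> convex_cone hull (blinfun_adjoint T ` ?A)"
  proof (rule farkas)
    show "finite (blinfun_adjoint T ` ?A)" by (simp add: finite_active F(1))
    fix h assume "\<And>s. s \<in> blinfun_adjoint T ` ?A \<Longrightarrow> s \<bullet> h \<le> 0"
    then have h: "a \<bullet> T h \<le> 0" if "(a, b) \<in> active F (g x)" for a b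
      using that by (force simp: blinfun_adjoint_inner)
    have "((\<lambda>t::real. g x + t *\<^sub>R T h) \<longlongrightarrow> g x + 0 *\<^sub>R T h) (at_right 0)"
      by (intro tendsto_intros)
    then have "filterlim (\<lambda>t::real. g x + t *\<^sub>R T h) (nhds (g x)) (at_right 0)" by simp
    from eventually_compose_filterlim[OF eventually_constraints_active[OF F x] this]
      eventually_at_right_less[of "0::real"]
    have "\<forall>\<^sub>F t in at_right 0. g x + t *\<^sub>R T h \<in> D"
      by eventually_elim (use h in \<open>force simp: mult_le_0_iff\<close>)
    then show "xs \<bullet> h \<le> 0"
      by (intro polar tangent_cone_constraint_set[OF g x cl err])
  qed
  also have "\<dots> = blinfun_adjoint T ` (convex_cone hull ?A)"
    by (rule convex_cone_hull_linear_image[OF linear_blinfun_adjoint])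
  finally show "xs \<in> blinfun_adjoint T ` convex_normals D (g x)"
    by (simp add: convex_normals_eq_active_cone[OF F x])
qed

text \<open>Let \<open>C\<close> be the adjoint of a left inverse of the transposed derivative on \<open>S\<close>. The map
  \<open>\<Phi> z = z + C (g z - g' x z)\<close> has the identity as its derivative at \<open>x\<close>, and
  \<open>n \<bullet> g' x (\<Phi> z) = n \<bullet> g z\<close> for all \<open>n\<close> in \<open>S\<close>. Hence in the coordinates \<open>\<Phi>\<close> the functions
  \<open>n \<bullet> g\<close> are linear, and constant on the lines with direction \<open>u\<close>; the curves \<open>\<xi>\<close> are the images of
  these lines. Their velocities tend to \<open>u\<close> because the derivative of \<open>\<Phi>\<close> tends to the identity.\<close>

lemma constraint_set_straightening:
  fixes g :: "'a::euclidean_space \<Rightarrow> 'b::euclidean_space" and g' :: "'a \<Rightarrow> 'a \<Rightarrow>\<^sub>L 'b"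
  assumes g: "\<And>x. (g has_derivative blinfun_apply (g' x)) (at x)"
    and cont: "continuous_on UNIV g'"
    and S: "subspace S" and inj: "\<And>n. n \<in> S \<Longrightarrow> blinfun_adjoint (g' x) n = 0 \<Longrightarrow> n = 0"
    and u: "\<And>n. n \<in> S \<Longrightarrow> n \<bullet> g' x u = 0"
  obtains p where "(p \<longlongrightarrow> u) (nhds x)"
    and "\<forall>\<^sub>F z in nhds x. \<exists>\<xi>. \<xi> 0 = z \<and> (\<xi> has_vector_derivative p z) (at 0) \<and>
      (\<forall>\<^sub>F s in nhds 0. \<forall>n\<in>S. n \<bullet> (g (\<xi> s) - g z) = 0)"
proof -
  obtain h where h: "bounded_linear h" "\<And>n. n \<in> S \<Longrightarrow> h (blinfun_adjoint (g' x) n) = n"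
    using blinfun_adjoint_left_inverse[OF S inj] by blast
  define C where "C = Blinfun (adjoint h)"
  have hl: "linear h" by (rule bounded_linear.linear[OF h(1)])
  have C: "C z = adjoint h z" for z
    using adjoint_linear[OF hl] by (simp add: C_def bounded_linear_Blinfun_apply linear_conv_bounded_linear)
  \<comment> \<open>\<open>C\<close> is a right inverse of the derivative as far as the functionals in \<open>S\<close> can see.\<close>
  have TC: "n \<bullet> g' x (C z) = n \<bullet> z" if "n \<in> S" for n z
  proof -
    have "n \<bullet> g' x (C z) = blinfun_adjoint (g' x) n \<bullet> adjoint h z"
      by (simp add: blinfun_adjoint_inner C)
    also have "\<dots> = n \<bullet> z" by (simp add: adjoint_works[OF hl] h(2)[OF that])
    finally show ?thesis .
  qed
  define \<Phi> where "\<Phi> z = z + C (g z - g' x z)" for z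
  define \<Phi>' where "\<Phi>' z = id_blinfun + (C o\<^sub>L (g' z - g' x))" for z
  have straight: "n \<bullet> g' x (\<Phi> z) = n \<bullet> g z" if "n \<in> S" for n z
    by (simp add: \<Phi>_def blinfun.add_right inner_add_right TC[OF that] inner_diff_right)
  have der: "(\<Phi> has_derivative blinfun_apply (\<Phi>' z)) (at z)" for z
  proof -
    have "((\<lambda>z. z + C (g z - g' x z)) has_derivative (\<lambda>h. h + C (g' z h - g' x h))) (at z)"
      by (intro has_derivative_add has_derivative_ident has_derivative_diff g
          bounded_linear.has_derivative[OF blinfun.bounded_linear_right]
          bounded_linear_imp_has_derivative[OF blinfun.bounded_linear_right])
    moreover have "blinfun_apply (\<Phi>' z) = (\<lambda>h. h + C (g' z h - g' x h))"
      by (simp add: \<Phi>'_def fun_eq_iff blinfun.bilinear_simps)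
    ultimately show ?thesis by (simp add: \<Phi>_def[abs_def])
  qed
  have cont': "continuous_on UNIV \<Phi>'"
    unfolding \<Phi>'_def by (intro continuous_intros cont bounded_bilinear.continuous_on[OF bounded_bilinear_blinfun_compose])
  have id: "id_blinfun o\<^sub>L \<Phi>' x = id_blinfun"
    by (rule blinfun_eqI) (simp add: \<Phi>'_def blinfun.bilinear_simps)
  obtain U V \<Psi> \<Psi>' where UV: "open U" "x \<in> U" "open V" "\<Phi> x \<in> V" "homeomorphism U V \<Phi> \<Psi>"
    and \<Psi>: "\<And>y. y \<in> V \<Longrightarrow> (\<Psi> has_derivative \<Psi>' y) (at y)"
      "\<And>y. y \<in> V \<Longrightarrow> \<Psi>' y = inv (blinfun_apply (\<Phi>' (\<Psi> y)))"
      "\<And>y. y \<in> V \<Longrightarrow> bij (blinfun_apply (\<Phi>' (\<Psi> y)))"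
    by (rule inverse_function_theorem[OF open_UNIV der cont' UNIV_I id]) auto
  define p where "p z = \<Psi>' (\<Phi> z) u" for z
  have U\<Phi>: "\<Phi> z \<in> V" "\<Psi> (\<Phi> z) = z" if "z \<in> U" for z
    using UV(5) that by (auto simp: homeomorphism_def)
  have V\<Psi>: "\<Phi> (\<Psi> y) = y" if "y \<in> V" for y
    using UV(5) that by (auto simp: homeomorphism_def)
  have \<Phi>'p: "\<Phi>' z (p z) = u" if "z \<in> U" for z
    using \<Psi>(2,3)[OF U\<Phi>(1)[OF that]] U\<Phi>(2)[OF that]
    by (simp add: p_def bij_is_surj surj_f_inv_f)
  have nhU: "\<forall>\<^sub>F z in nhds x. z \<in> U" using UV(1,2) by (rule eventually_nhds_in_open)
  show ?thesis
  proof
    have "((\<lambda>z. norm (C o\<^sub>L (g' z - g' x))) \<longlongrightarrow> norm (C o\<^sub>L (g' x - g' x))) (at x)"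
      using cont by (intro tendsto_norm bounded_bilinear.tendsto[OF bounded_bilinear_blinfun_compose] tendsto_intros)
        (auto simp: continuous_on_def)
    then have E: "((\<lambda>z. norm (C o\<^sub>L (g' z - g' x))) \<longlongrightarrow> 0) (nhds x)"
      by (simp add: tendsto_nhds_iff)
    then have "((\<lambda>z. norm (C o\<^sub>L (g' z - g' x)) * (2 * norm u)) \<longlongrightarrow> 0 * (2 * norm u)) (nhds x)"
      by (intro tendsto_intros)
    then have E0: "((\<lambda>z. norm (C o\<^sub>L (g' z - g' x)) * (2 * norm u)) \<longlongrightarrow> 0) (nhds x)"
      by simp
    have "\<forall>\<^sub>F z in nhds x. norm (C o\<^sub>L (g' z - g' x)) < 1 / 2"
      using order_tendstoD(2)[OF E, of "1/2"] by simp
    then have "\<forall>\<^sub>F z in nhds x. norm (p z - u) \<le> norm (C o\<^sub>L (g' z - g' x)) * (2 * norm u)"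
      using nhU
    proof eventually_elim
      case (elim z)
      let ?E = "C o\<^sub>L (g' z - g' x)"
      have eq: "u - p z = ?E (p z)"
        using \<Phi>'p[OF elim(2)] by (simp add: \<Phi>'_def blinfun.add_left algebra_simps)
      have le: "norm (p z - u) \<le> norm ?E * norm (p z)"
        unfolding norm_minus_commute[of "p z"] eq by (rule norm_blinfun)
      have "norm (p z) \<le> norm u + norm (p z - u)"
        using norm_triangle_sub[of "p z" u] .
      also have "\<dots> \<le> norm u + 1 / 2 * norm (p z)"
      proof -
        have "norm ?E * norm (p z) \<le> 1 / 2 * norm (p z)"
          using elim(1) by (intro mult_right_mono) auto
        with le show ?thesis by simp
      qed
      finally have "norm (p z) \<le> 2 * norm u" by simp
      then have "norm ?E * norm (p z) \<le> norm ?E * (2 * norm u)"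
        by (rule mult_left_mono) simp
      with le show ?case by (rule order_trans)
    qed
    from Lim_null_comparison[OF this E0] show "(p \<longlongrightarrow> u) (nhds x)" by (simp add: LIM_zero_iff)
    show "\<forall>\<^sub>F z in nhds x. \<exists>\<xi>. \<xi> 0 = z \<and> (\<xi> has_vector_derivative p z) (at 0) \<and>
      (\<forall>\<^sub>F s in nhds 0. \<forall>n\<in>S. n \<bullet> (g (\<xi> s) - g z) = 0)"
      using nhU
    proof (rule eventually_mono)
      fix z assume z: "z \<in> U"
      define \<xi> where "\<xi> s = \<Psi> (\<Phi> z + s *\<^sub>R u)" for s
      have "\<xi> 0 = z" by (simp add: \<xi>_def U\<Phi> z)
      moreover have "(\<xi> has_vector_derivative p z) (at 0)"
      proof -
        have "((\<lambda>s. \<Phi> z + s *\<^sub>R u) has_derivative (\<lambda>s. s *\<^sub>R u)) (at 0)"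
          by (auto intro!: derivative_eq_intros)
        moreover have "(\<Psi> has_derivative \<Psi>' (\<Phi> z)) (at (\<Phi> z + 0 *\<^sub>R u))"
          using \<Psi>(1)[OF U\<Phi>(1)[OF z]] by simp
        ultimately have "((\<lambda>s. \<Psi> (\<Phi> z + s *\<^sub>R u)) has_derivative (\<lambda>s. \<Psi>' (\<Phi> z) (s *\<^sub>R u))) (at 0)"
          by (rule has_derivative_compose)
        moreover have "linear (\<Psi>' (\<Phi> z))"
          using \<Psi>(1)[OF U\<Phi>(1)[OF z]] has_derivative_linear by blast
        ultimately show ?thesis
          by (simp add: has_vector_derivative_def \<xi>_def[abs_def] p_def linear_cmul)
      qed
      moreover have "\<forall>\<^sub>F s in nhds 0. \<forall>n\<in>S. n \<bullet> (g (\<xi> s) - g z) = 0"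
      proof -
        have "((\<lambda>s. \<Phi> z + s *\<^sub>R u) \<longlongrightarrow> \<Phi> z + 0 *\<^sub>R u) (nhds 0)"
          by (intro tendsto_intros filterlim_ident)
        then have "\<forall>\<^sub>F s in nhds 0. \<Phi> z + s *\<^sub>R u \<in> V"
          using topological_tendstoD[OF _ UV(3)] U\<Phi>(1)[OF z] by simp
        then show ?thesis
        proof (rule eventually_mono, intro ballI)
          fix s n assume s: "\<Phi> z + s *\<^sub>R u \<in> V" and n: "n \<in> S"
          have "n \<bullet> g (\<xi> s) = n \<bullet> g' x (\<Phi> z + s *\<^sub>R u)"
            by (simp add: straight[OF n, symmetric] \<xi>_def V\<Psi>[OF s])
          also have "\<dots> = n \<bullet> g z"
            by (simp add: blinfun.bilinear_simps inner_add_right u[OF n] straight[OF n])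
          finally show "n \<bullet> (g (\<xi> s) - g z) = 0" by (simp add: inner_diff_right)
        qed
      qed
      ultimately show "\<exists>\<xi>. \<xi> 0 = z \<and> (\<xi> has_vector_derivative p z) (at 0) \<and>
        (\<forall>\<^sub>F s in nhds 0. \<forall>n\<in>S. n \<bullet> (g (\<xi> s) - g z) = 0)" by blast
    qed
  qed
qed

text \<open>The multiplier rule passes from regular to limiting normals because injectivity on \<open>S\<close> keeps the
  multipliers of nearby regular normals convergent, and because these multipliers already lie in the
  closed cone \<open>convex_normals D (g z)\<close>.\<close>

lemma limiting_normal_cone_constraint_set:
  fixes g :: "'a::euclidean_space \<Rightarrow> 'b::euclidean_space" and g' :: "'a \<Rightarrow> 'a \<Rightarrow>\<^sub>L 'b"
  assumes D: "polyhedron D"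
    and g: "\<And>x. (g has_derivative blinfun_apply (g' x)) (at x)"
    and cont: "continuous_on UNIV g'"
    and U: "open U" "z \<in> U"
    and err: "\<And>x. x \<in> U \<Longrightarrow> infdist x {x. g x \<in> D} \<le> \<kappa> * infdist (g x) D"
    and S: "subspace S" "convex_normals D (g z) \<subseteq> S"
    and inj: "\<And>n. n \<in> S \<Longrightarrow> blinfun_adjoint (g' z) n = 0 \<Longrightarrow> n = 0"
  shows "limiting_normal_cone {x. g x \<in> D} z \<subseteq> blinfun_adjoint (g' z) ` convex_normals D (g z)"
proof
  fix xs assume "xs \<in> limiting_normal_cone {x. g x \<in> D} z"
  then obtain zk zsk where z: "g z \<in> D" and lims: "zk \<longlonglongrightarrow> z" "zsk \<longlonglongrightarrow> xs"
    and reg: "\<And>k. zsk k \<in> regular_normal_cone {x. g x \<in> D} (zk k)"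
    by (auto simp: limiting_normal_cone_def)
  have gcont: "isCont g x" for x using g has_derivative_continuous by blast
  have g'cont: "isCont g' x" for x using cont by (simp add: continuous_on_eq_continuous_at)
  have cl: "closed {x. g x \<in> D}"
    using closed_vimage[OF polyhedron_imp_closed[OF D], of g] gcont
    by (simp add: vimage_def continuous_at_imp_continuous_on)
  have feas: "g (zk k) \<in> D" for k
    using reg[of k] by (auto simp: regular_normal_cone_def split: if_splits)
  have evU: "\<forall>\<^sub>F k in sequentially. zk k \<in> U"
    using topological_tendstoD[OF lims(1) U] .
  have gz: "(\<lambda>k. g (zk k)) \<longlonglongrightarrow> g z"
    using isCont_tendsto_compose[OF gcont lims(1)] .
  have evN: "\<forall>\<^sub>F k in sequentially. convex_normals D (g (zk k)) \<subseteq> convex_normals D (g z)"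
    using eventually_compose_filterlim[OF convex_normals_outer_semicontinuous[OF D z] gz] feas by simp
  have "\<forall>\<^sub>F k in sequentially. \<exists>n\<in>convex_normals D (g z). blinfun_adjoint (g' (zk k)) n = zsk k"
    using evU evN
  proof eventually_elim
    case (elim k)
    have "\<forall>\<^sub>F x in nhds (zk k). x \<in> U" by (rule eventually_nhds_in_open[OF U(1) elim(1)])
    then have "\<forall>\<^sub>F x in nhds (zk k). infdist x {x. g x \<in> D} \<le> \<kappa> * infdist (g x) D"
      by (rule eventually_mono) (rule err)
    from regular_normal_cone_constraint_set[OF D g cl this] reg[of k] elim(2) show ?case by fastforce
  qed
  then have m_ex: "\<forall>\<^sub>F k in sequentially. \<exists>n. n \<in> convex_normals D (g z) \<and>
      blinfun_adjoint (g' (zk k)) n = zsk k"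
    unfolding Bex_def .
  define m where "m k = (SOME n. n \<in> convex_normals D (g z) \<and>
      blinfun_adjoint (g' (zk k)) n = zsk k)" for k
  have m: "\<forall>\<^sub>F k in sequentially. m k \<in> convex_normals D (g z) \<and>
      blinfun_adjoint (g' (zk k)) (m k) = zsk k"
    using m_ex unfolding m_def by (rule eventually_mono) (rule someI_ex)
  have mN: "\<forall>\<^sub>F k in sequentially. m k \<in> convex_normals D (g z)"
    and ma: "\<forall>\<^sub>F k in sequentially. zsk k = blinfun_adjoint (g' (zk k)) (m k)"
    using m by (auto elim: eventually_mono)
  have mS: "\<forall>\<^sub>F k in sequentially. m k \<in> S" using mN S(2) by (auto elim: eventually_mono)
  have lim: "(\<lambda>k. blinfun_adjoint (g' (zk k)) (m k)) \<longlonglongrightarrow> xs"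
    using lims(2) ma by (rule Lim_transform_eventually)
  obtain n where n: "m \<longlonglongrightarrow> n" "blinfun_adjoint (g' z) n = xs"
    using blinfun_adjoint_multipliers_converge
      [OF S(1) inj isCont_tendsto_compose[OF g'cont lims(1)] mS lim] by blast
  have "n \<in> convex_normals D (g z)"
    using Lim_in_closed_set[OF polyhedron_imp_closed[OF polyhedron_convex_normals[OF D z]] mN _ n(1)]
    by simp
  with n(2) show "xs \<in> blinfun_adjoint (g' z) ` convex_normals D (g z)" by blast
qed

section \<open>Tangents to the graph of the normal cone mapping\<close>

text \<open>Along the curve \<open>\<xi>\<close> the point \<open>g (\<xi> s)\<close> stays on one face of \<open>D\<close>, so \<open>m + s \<eta>\<close> remains a normal
  there. Thus \<open>s \<mapsto> (\<xi> s, g' (\<xi> s)\<^sup>* (m + s \<eta>))\<close> is a curve in the graph, and the vector in the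
  conclusion is its derivative at \<open>0\<close>.\<close>

lemma tangent_to_normal_cone_graph:
  fixes g :: "'a::euclidean_space \<Rightarrow> 'b::euclidean_space" and g' :: "'a \<Rightarrow> 'a \<Rightarrow>\<^sub>L 'b"
  assumes D: "polyhedron D"
    and g: "\<And>x. (g has_derivative blinfun_apply (g' x)) (at x)"
    and g'': "(g' has_derivative blinfun_apply G) (at z)"
    and z: "g z \<in> D"
    and m: "\<forall>\<^sub>F s in nhds 0. m + s *\<^sub>R \<eta> \<in> convex_normals D (g z)"
    and \<xi>0: "\<xi> 0 = z" and \<xi>: "(\<xi> has_vector_derivative p) (at 0)"
    and \<xi>S: "\<forall>\<^sub>F s in nhds 0. \<forall>n\<in>convex_normals D (g z). n \<bullet> (g (\<xi> s) - g z) = 0"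
  shows "(p, blinfun_adjoint (G p) m + blinfun_adjoint (g' z) \<eta>) \<in>
    tangent_cone (gph (limiting_normal_cone {x. g x \<in> D})) (z, blinfun_adjoint (g' z) m)"
proof -
  let ?M = "gph (limiting_normal_cone {x. g x \<in> D})"
  let ?q = "blinfun_adjoint (G p) m + blinfun_adjoint (g' z) \<eta>"
  define c where "c s = (\<xi> s, blinfun_adjoint (g' (\<xi> s)) (m + s *\<^sub>R \<eta>))" for s
  have in_gph: "(x, blinfun_adjoint (g' x) n) \<in> ?M" if "g x \<in> D" "n \<in> convex_normals D (g x)" for x n
    using blinfun_adjoint_convex_normals_regular[OF g that] regular_normal_cone_subset_limiting
    by (auto simp: gph_def)
  have "isCont \<xi> 0" using \<xi> by (rule has_vector_derivative_continuous)
  then have "isCont (\<lambda>s. g (\<xi> s)) 0"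
    by (rule isCont_o2) (use g has_derivative_continuous in blast)
  then have "filterlim (\<lambda>s. g (\<xi> s)) (nhds (g z)) (nhds 0)"
    by (simp add: isCont_def tendsto_nhds_iff \<xi>0)
  from eventually_compose_filterlim[OF convex_normals_along_face[OF D z] this] m \<xi>S
  have ev: "\<forall>\<^sub>F s in nhds 0. c s \<in> ?M"
  proof eventually_elim
    case (elim s)
    then show ?case unfolding c_def by (intro in_gph) auto
  qed
  have c0: "c 0 = (z, blinfun_adjoint (g' z) m)" by (simp add: c_def \<xi>0)
  have "(c has_derivative (\<lambda>s. (s *\<^sub>R p, blinfun_adjoint (g' z) (s *\<^sub>R \<eta>) + blinfun_adjoint (G (s *\<^sub>R p)) m))) (at 0)"
  proof -
    have d\<xi>: "(\<xi> has_derivative (\<lambda>s. s *\<^sub>R p)) (at 0)" using \<xi> by (simp add: has_vector_derivative_def)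
    have "(g' has_derivative blinfun_apply G) (at (\<xi> 0))" using g'' \<xi>0 by simp
    from has_derivative_compose[OF d\<xi> this]
    have 1: "((\<lambda>s. g' (\<xi> s)) has_derivative (\<lambda>s. G (s *\<^sub>R p))) (at 0)" .
    have 2: "((\<lambda>s. m + s *\<^sub>R \<eta>) has_derivative (\<lambda>s. s *\<^sub>R \<eta>)) (at 0)"
      by (auto intro!: derivative_eq_intros)
    from has_derivative_Pair[OF d\<xi> bounded_bilinear.FDERIV[OF bounded_bilinear_blinfun_adjoint 1 2]]
    show ?thesis by (simp add: c_def[abs_def] \<xi>0)
  qed
  from difference_quotient_tendsto[OF this, of "\<lambda>s. s" "at_right 0" "\<lambda>_. 1" 1]
  have lim: "((\<lambda>s. (c s - c 0) /\<^sub>R s) \<longlongrightarrow> (p, ?q)) (at_right 0)"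
    by (simp add: eventually_at_filter add.commute)
  have "\<forall>\<^sub>F s in at_right 0. c s \<in> ?M"
    using ev unfolding eventually_at_filter by (rule eventually_mono) simp
  moreover have "c 0 \<in> ?M" using eventually_nhds_x_imp_x[OF ev] .
  ultimately show ?thesis
    using tangent_coneI_curve[OF _ _ lim] by (simp add: c0)
qed

text \<open>Traversing the same curve backwards shows that the negative of the tangent is a tangent as well.\<close>

lemma normal_orthogonal_to_two_sided_tangent:
  fixes g :: "'a::euclidean_space \<Rightarrow> 'b::euclidean_space" and g' :: "'a \<Rightarrow> 'a \<Rightarrow>\<^sub>L 'b"
  assumes D: "polyhedron D"
    and g: "\<And>x. (g has_derivative blinfun_apply (g' x)) (at x)"
    and g'': "(g' has_derivative blinfun_apply G) (at z)"
    and z: "g z \<in> D"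
    and m: "\<forall>\<^sub>F s in nhds 0. m + s *\<^sub>R \<eta> \<in> convex_normals D (g z)"
    and \<xi>0: "\<xi> 0 = z" and \<xi>: "(\<xi> has_vector_derivative p) (at 0)"
    and \<xi>S: "\<forall>\<^sub>F s in nhds 0. \<forall>n\<in>convex_normals D (g z). n \<bullet> (g (\<xi> s) - g z) = 0"
    and N: "N \<in> regular_normal_cone (gph (limiting_normal_cone {x. g x \<in> D}))
      (z, blinfun_adjoint (g' z) m)"
  shows "N \<bullet> (p, blinfun_adjoint (G p) m + blinfun_adjoint (g' z) \<eta>) = 0"
proof -
  have polar: "N \<bullet> w \<le> 0" if "w \<in> tangent_cone (gph (limiting_normal_cone {x. g x \<in> D}))
      (z, blinfun_adjoint (g' z) m)" for w
    using N that by (auto simp: regular_normal_cone_def negative_polar_def split: if_splits)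
  have "((\<lambda>s. - s) \<longlongrightarrow> - 0) (nhds (0::real))" by (intro tendsto_minus filterlim_ident)
  then have neg: "filterlim uminus (nhds 0) (nhds (0::real))" by simp
  have "((\<xi> \<circ> uminus) has_vector_derivative - 1 *\<^sub>R p) (at 0)"
    using \<xi> by (intro vector_diff_chain_at) (auto intro!: derivative_eq_intros)
  then have \<xi>': "((\<lambda>s. \<xi> (- s)) has_vector_derivative - p) (at 0)" by (simp add: o_def)
  have "(- p, blinfun_adjoint (G (- p)) m + blinfun_adjoint (g' z) (- \<eta>)) \<in>
    tangent_cone (gph (limiting_normal_cone {x. g x \<in> D})) (z, blinfun_adjoint (g' z) m)"
  proof (rule tangent_to_normal_cone_graph[OF D g g'' z _ _ \<xi>'])
    show "\<forall>\<^sub>F s in nhds 0. m + s *\<^sub>R - \<eta> \<in> convex_normals D (g z)"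
      using eventually_compose_filterlim[OF m neg] by simp
    show "\<forall>\<^sub>F s in nhds 0. \<forall>n\<in>convex_normals D (g z). n \<bullet> (g (\<xi> (- s)) - g z) = 0"
      using eventually_compose_filterlim[OF \<xi>S neg] by simp
  qed (simp add: \<xi>0)
  from polar[OF this] polar[OF tangent_to_normal_cone_graph[OF D g g'' z m \<xi>0 \<xi> \<xi>S]]
  show ?thesis
    by (cases N) (simp add: blinfun.minus_right inner_add_right inner_diff_right inner_minus_right
        bounded_bilinear.minus_left[OF bounded_bilinear_blinfun_adjoint]
        bounded_bilinear.minus_right[OF bounded_bilinear_blinfun_adjoint])
qed

section \<open>The semismooth* property\<close>

text \<open>This brings in the direction: a normal \<open>n\<close> common to \<open>y\<close> and all the points \<open>y + t k v k\<close> is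
  orthogonal to every \<open>v k\<close>, so to their limit \<open>w\<close>, and the normals at \<open>y\<close> orthogonal to \<open>w\<close> are
  normals to the tangent cone at \<open>w\<close>. So the non-degeneracy condition controls the
  multipliers that occur along a sequence approaching in direction \<open>w\<close>.\<close>

lemma polyhedral_normals_in_directional_cone:
  assumes D: "polyhedron D" and y: "y \<in> D" and t: "\<And>k. t k > 0" "t \<longlonglongrightarrow> 0"
    and v: "v \<longlonglongrightarrow> w" and yk: "\<And>k. y + t k *\<^sub>R v k \<in> D"
    and K: "\<And>k. convex_normals D (y + t k *\<^sub>R v k) = K"
  shows "K \<subseteq> limiting_normal_cone (tangent_cone D y) w" and "\<And>n. n \<in> K \<Longrightarrow> n \<bullet> w = 0"
proof -
  have w: "w \<in> tangent_cone D y"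
    using y t v yk by (auto simp: tangent_cone_def)
  have "(\<lambda>k. y + t k *\<^sub>R v k) \<longlonglongrightarrow> y + 0 *\<^sub>R w" by (intro tendsto_intros t v)
  then have "filterlim (\<lambda>k. y + t k *\<^sub>R v k) (nhds y) sequentially" by simp
  from eventually_compose_filterlim[OF convex_normals_outer_semicontinuous[OF D y] this]
  have sub: "K \<subseteq> convex_normals D y"
    by (simp add: yk K)
  show perp: "n \<bullet> w = 0" if n: "n \<in> K" for n
  proof -
    have "n \<bullet> v k = 0" for k
    proof -
      have "n \<in> convex_normals D (y + t k *\<^sub>R v k)" using n K by simp
      then have "n \<bullet> (y - (y + t k *\<^sub>R v k)) \<le> 0" using y unfolding convex_normals_def by blast
      moreover have "n \<bullet> (y + t k *\<^sub>R v k - y) \<le> 0"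
        using n sub yk[of k] unfolding convex_normals_def by blast
      ultimately show ?thesis using t(1)[of k] by (simp add: mult_le_0_iff zero_le_mult_iff)
    qed
    then show ?thesis using tendsto_inner[OF tendsto_const v, of n] by (simp add: LIMSEQ_const_iff)
  qed
  show "K \<subseteq> limiting_normal_cone (tangent_cone D y) w"
  proof
    fix n assume n: "n \<in> K"
    have le: "n \<bullet> h \<le> 0" if h: "h \<in> tangent_cone D y" for h
    proof -
      from h obtain \<tau> hs where "\<And>k. \<tau> k > (0::real)" "hs \<longlonglongrightarrow> h" "\<And>k. y + \<tau> k *\<^sub>R hs k \<in> D"
        by (auto simp: tangent_cone_def)
      moreover have "n \<bullet> hs k \<le> 0" for k
      proof -
        have "n \<bullet> (y + \<tau> k *\<^sub>R hs k - y) \<le> 0"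
          using n sub \<open>y + \<tau> k *\<^sub>R hs k \<in> D\<close> unfolding convex_normals_def by blast
        with \<open>\<tau> k > 0\<close> show ?thesis by (simp add: mult_le_0_iff)
      qed
      ultimately show ?thesis
        using LIMSEQ_le_const2[OF tendsto_inner[OF tendsto_const], of hs h n 0] by blast
    qed
    have "n \<bullet> h \<le> 0" if h: "h \<in> tangent_cone (tangent_cone D y) w" for h
    proof -
      from h obtain \<tau> hs where \<tau>: "\<And>k. \<tau> k > (0::real)" "hs \<longlonglongrightarrow> h"
        "\<And>k. w + \<tau> k *\<^sub>R hs k \<in> tangent_cone D y"
        unfolding tangent_cone_def[of "tangent_cone D y"] by blast
      have "n \<bullet> hs k \<le> 0" for k
        using le[OF \<tau>(3)[of k]] \<tau>(1)[of k] perp[OF n] by (simp add: inner_add_right mult_le_0_iff)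
      then show ?thesis
        using LIMSEQ_le_const2[OF tendsto_inner[OF tendsto_const \<tau>(2)], of n 0] by blast
    qed
    with w have "n \<in> regular_normal_cone (tangent_cone D y) w"
      by (simp add: regular_normal_cone_def negative_polar_def)
    then show "n \<in> limiting_normal_cone (tangent_cone D y) w"
      using regular_normal_cone_subset_limiting by blast
  qed
qed


text \<open>The base point only has to lie in an open set on which the error bound holds. The sequences that
  define a directional normal are thinned out until the normal cones to \<open>D\<close> are constant, the
  transposed derivative at each member is injective on the span of that cone, and the multipliers stay on one face. Then each member of the
  sequence of normals is orthogonal to a tangent, and these tangents converge to \<open>(u, us)\<close>.\<close>

lemma semismooth_star_constraint_normals:
  fixes g :: "'a::euclidean_space \<Rightarrow> 'b::euclidean_space" and g' :: "'a \<Rightarrow> 'a \<Rightarrow>\<^sub>L 'b"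
  assumes D: "polyhedron D"
    and g: "\<And>x. (g has_derivative blinfun_apply (g' x)) (at x)"
    and g'': "\<And>x. (g' has_derivative blinfun_apply (g'' x)) (at x)"
    and cont: "continuous_on UNIV g''"
    and U: "open U" "x \<in> U"
    and err: "\<And>x. x \<in> U \<Longrightarrow> infdist x {x. g x \<in> D} \<le> \<kappa> * infdist (g x) D"
    and nondeg: "\<And>\<mu>. blinfun_adjoint (g' x) \<mu> = 0 \<Longrightarrow>
      \<mu> \<in> span (limiting_normal_cone (tangent_cone D (g x)) (g' x u)) \<Longrightarrow> \<mu> = 0"
  shows "semismooth_star_in_direction (limiting_normal_cone {x. g x \<in> D}) (x, xs) (u, us)"
proof -
  let ?N = "limiting_normal_cone {x. g x \<in> D}"
  have "u \<bullet> ws = us \<bullet> vs" if "(ws, - vs) \<in> directional_normal_cone (gph ?N) (x, xs) (u, us)" for ws vs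
  proof -
    from that obtain t d n where t: "\<And>k. t k > 0" "t \<longlonglongrightarrow> 0" and d: "d \<longlonglongrightarrow> (u, us)"
      and n: "n \<longlonglongrightarrow> (ws, - vs)"
      and reg: "\<And>k. n k \<in> regular_normal_cone (gph ?N) ((x, xs) + t k *\<^sub>R d k)"
      and x: "g x \<in> D"
      by (auto simp: directional_normal_cone_def gph_def limiting_normal_cone_def)
    define z where "z k = x + t k *\<^sub>R fst (d k)" for k
    define q where "q k = xs + t k *\<^sub>R snd (d k)" for k
    have zq: "(x, xs) + t k *\<^sub>R d k = (z k, q k)" for k
      by (simp add: z_def q_def prod_eq_iff)
    have gr: "(z k, q k) \<in> gph ?N" for k
      using reg[of k] by (auto simp: zq regular_normal_cone_def split: if_splits)
    then have feas: "g (z k) \<in> D" and qN: "q k \<in> ?N (z k)" for k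
      by (auto simp: gph_def limiting_normal_cone_def)
    have du: "(\<lambda>k. fst (d k)) \<longlonglongrightarrow> u" and dus: "(\<lambda>k. snd (d k)) \<longlonglongrightarrow> us"
      using tendsto_fst[OF d] tendsto_snd[OF d] by simp_all
    have "(\<lambda>k. x + t k *\<^sub>R fst (d k)) \<longlonglongrightarrow> x + 0 *\<^sub>R u" by (intro tendsto_intros t du)
    then have zx: "z \<longlonglongrightarrow> x" by (simp add: z_def[abs_def])
    have "(\<lambda>k. xs + t k *\<^sub>R snd (d k)) \<longlonglongrightarrow> xs + 0 *\<^sub>R us" by (intro tendsto_intros t dus)
    then have qxs: "q \<longlonglongrightarrow> xs" by (simp add: q_def[abs_def])
    have nz: "t k \<noteq> 0" for k using t(1)[of k] by simp
    have nz': "\<forall>\<^sub>F k in sequentially. t k \<noteq> 0" using nz by simp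
    have gv: "(\<lambda>k. (g (z k) - g x) /\<^sub>R t k) \<longlonglongrightarrow> g' x u"
      unfolding z_def by (rule difference_quotient_tendsto[OF g t(2) nz' du])
    have g'v: "(\<lambda>k. (g' (z k) - g' x) /\<^sub>R t k) \<longlonglongrightarrow> g'' x u"
      unfolding z_def by (rule difference_quotient_tendsto[OF g'' t(2) nz' du])
    have g'cont: "isCont g' y" for y using g'' has_derivative_continuous by blast
    then have g'UNIV: "continuous_on UNIV g'" by (simp add: continuous_on_eq_continuous_at)
    have g''cont: "isCont g'' y" for y using cont by (simp add: continuous_on_eq_continuous_at)

    \<comment> \<open>A polyhedron has only finitely many normal cones, so one of them, \<open>K\<close>, occurs infinitely often.\<close>
    have "finite (range (\<lambda>k. convex_normals D (g (z k))))"
      by (rule finite_subset[OF _ finite_range_convex_normals[OF D]]) (use feas in auto)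
    then obtain r1 :: "nat \<Rightarrow> nat" where r1: "strict_mono r1"
      "\<And>k. convex_normals D (g (z (r1 k))) = convex_normals D (g (z (r1 0)))"
      using subsequence_with_constant_image by blast
    define K where "K = convex_normals D (g (z (r1 0)))"
    have K: "convex_normals D (g (z (r1 k))) = K" for k using r1(2) by (simp add: K_def)
    have pK: "polyhedron K" unfolding K_def by (rule polyhedron_convex_normals[OF D feas])
    define S where "S = span K"
    have S: "subspace S" "K \<subseteq> S" by (auto simp: S_def span_superset)
    have gz: "g x + t k *\<^sub>R ((g (z k) - g x) /\<^sub>R t k) = g (z k)" for k by (simp add: nz)
    have Kcone: "K \<subseteq> limiting_normal_cone (tangent_cone D (g x)) (g' x u)"
      and Kperp: "\<And>n. n \<in> K \<Longrightarrow> n \<bullet> g' x u = 0"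
      using polyhedral_normals_in_directional_cone[OF D x, of "\<lambda>k. t (r1 k)"
          "\<lambda>k. (g (z (r1 k)) - g x) /\<^sub>R t (r1 k)" "g' x u" K]
        LIMSEQ_subseq_LIMSEQ[OF gv r1(1)] LIMSEQ_subseq_LIMSEQ[OF t(2) r1(1)]
      by (simp_all only: t(1) gz feas K o_def)
    have inj: "n = 0" if "n \<in> S" "blinfun_adjoint (g' x) n = 0" for n
      using nondeg that span_mono[OF Kcone] by (auto simp: S_def)
    have Sperp: "n \<bullet> g' x u = 0" if "n \<in> S" for n
      using that unfolding S_def
      by (induction rule: span_induct_alt) (auto simp: inner_add_left Kperp)

    obtain p where p: "(p \<longlongrightarrow> u) (nhds x)"
      and curves: "\<forall>\<^sub>F z in nhds x. \<exists>\<xi>. \<xi> 0 = z \<and> (\<xi> has_vector_derivative p z) (at 0) \<and>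
        (\<forall>\<^sub>F s in nhds 0. \<forall>n\<in>S. n \<bullet> (g (\<xi> s) - g z) = 0)"
      using constraint_set_straightening[OF g g'UNIV S(1) inj Sperp] by blast
    obtain C where C: "C > 0"
      "\<forall>\<^sub>F T in nhds (g' x). \<forall>n\<in>S. norm n \<le> C * norm (blinfun_adjoint T n)"
      using blinfun_adjoint_uniformly_injective[OF S(1) inj] by blast
    have zr1: "(\<lambda>k. z (r1 k)) \<longlonglongrightarrow> x" using LIMSEQ_subseq_LIMSEQ[OF zx r1(1)] by (simp add: o_def)
    define good where "good y \<longleftrightarrow> y \<in> U \<and>
      (\<forall>n\<in>S. norm n \<le> C * norm (blinfun_adjoint (g' y) n)) \<and>
      (\<exists>\<xi>. \<xi> 0 = y \<and> (\<xi> has_vector_derivative p y) (at 0) \<and>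
        (\<forall>\<^sub>F s in nhds 0. \<forall>n\<in>S. n \<bullet> (g (\<xi> s) - g y) = 0))" for y
    have "\<forall>\<^sub>F k in sequentially. good (z (r1 k))"
      using topological_tendstoD[OF zr1 U] eventually_compose_filterlim[OF curves zr1]
        eventually_compose_filterlim[OF C(2) isCont_tendsto_compose[OF g'cont zr1]]
      unfolding good_def by eventually_elim (intro conjI)
    then obtain r2 :: "nat \<Rightarrow> nat" where r2: "strict_mono r2" and good: "\<And>k. good (z (r1 (r2 k)))"
      by (rule eventually_subsequence_all) blast
    have "\<exists>m. m \<in> K \<and> blinfun_adjoint (g' (z (r1 (r2 k)))) m = q (r1 (r2 k))" for k
    proof -
      have inj': "n = 0" if "n \<in> S" "blinfun_adjoint (g' (z (r1 (r2 k)))) n = 0" for n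
      proof -
        have "norm n \<le> C * norm (blinfun_adjoint (g' (z (r1 (r2 k)))) n)"
          using good[of k] that(1) by (simp add: good_def)
        with that(2) show ?thesis by simp
      qed
      have zU: "z (r1 (r2 k)) \<in> U" using good[of k] by (simp add: good_def)
      have "convex_normals D (g (z (r1 (r2 k)))) \<subseteq> S" by (simp add: K S(2))
      from limiting_normal_cone_constraint_set[OF D g g'UNIV U(1) zU err S(1) this inj']
      have "?N (z (r1 (r2 k))) \<subseteq> blinfun_adjoint (g' (z (r1 (r2 k)))) ` K"
        unfolding K .
      from subsetD[OF this qN[of "r1 (r2 k)"]] show ?thesis by (auto simp only: image_iff)
    qed
    then obtain m where m: "\<And>k. m k \<in> K"
      "\<And>k. blinfun_adjoint (g' (z (r1 (r2 k)))) (m k) = q (r1 (r2 k))" by metis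
    have r12: "strict_mono (\<lambda>k. r1 (r2 k))"
      using strict_mono_o[OF r1(1) r2] by (simp add: o_def)
    have "(\<lambda>k. z (r1 (r2 k))) \<longlonglongrightarrow> x" "(\<lambda>k. q (r1 (r2 k))) \<longlonglongrightarrow> xs"
      using LIMSEQ_subseq_LIMSEQ[OF zx r12] LIMSEQ_subseq_LIMSEQ[OF qxs r12] by (simp_all add: o_def)
    moreover have "\<forall>\<^sub>F k in sequentially. m k \<in> S"
      by (intro always_eventually allI subsetD[OF S(2) m(1)])
    ultimately obtain l where l: "l \<in> S" "m \<longlonglongrightarrow> l" "blinfun_adjoint (g' x) l = xs"
      using blinfun_adjoint_multipliers_converge[OF S(1) inj, where Tj = "\<lambda>k. g' (z (r1 (r2 k)))" and m = m and q = xs]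
        isCont_tendsto_compose[OF g'cont, of "\<lambda>k. z (r1 (r2 k))" x] by (auto simp: m(2))
    obtain r3 :: "nat \<Rightarrow> nat" where r3: "strict_mono r3"
      "\<And>k. \<forall>\<^sub>F s in nhds 0. m (r3 k) + s *\<^sub>R (m (r3 k) - l) \<in> K"
      using polyhedron_line_extension[OF pK m(1) l(2)] by blast
    define \<rho> where "\<rho> k = r1 (r2 (r3 k))" for k
    have \<rho>: "strict_mono \<rho>" using strict_mono_o[OF r12 r3(1)] by (simp add: o_def \<rho>_def[abs_def])
    have sub: "(\<lambda>k. f (\<rho> k)) \<longlonglongrightarrow> L" if "f \<longlonglongrightarrow> L" for f :: "nat \<Rightarrow> 'c::topological_space" and L
      using LIMSEQ_subseq_LIMSEQ[OF that \<rho>] by (simp add: o_def)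
    \<comment> \<open>The multipliers move with velocity \<open>\<eta>\<close>, and \<open>\<zeta>\<close> is the resulting velocity of the normals
      along the curve through \<open>z (\<rho> k)\<close>.\<close>
    define \<eta> where "\<eta> k = (m (r3 k) - l) /\<^sub>R t (\<rho> k)" for k
    define \<zeta> where "\<zeta> k = blinfun_adjoint (g'' (z (\<rho> k)) (p (z (\<rho> k)))) (m (r3 k)) +
      blinfun_adjoint (g' (z (\<rho> k))) (\<eta> k)" for k
    have mr: "(\<lambda>k. m (r3 k)) \<longlonglongrightarrow> l" using LIMSEQ_subseq_LIMSEQ[OF l(2) r3(1)] by (simp add: o_def)
    have orth: "n (\<rho> k) \<bullet> (p (z (\<rho> k)), \<zeta> k) = 0" for k
    proof -
      have KN: "convex_normals D (g (z (\<rho> k))) = K" by (simp add: \<rho>_def K)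
      have "((\<lambda>s. s / t (\<rho> k)) \<longlongrightarrow> 0 / t (\<rho> k)) (nhds 0)"
        by (intro tendsto_intros filterlim_ident) (rule nz)
      then have "filterlim (\<lambda>s. s / t (\<rho> k)) (nhds 0) (nhds 0)" by simp
      from eventually_compose_filterlim[OF r3(2)[of k] this]
      have line: "\<forall>\<^sub>F s in nhds 0. m (r3 k) + s *\<^sub>R \<eta> k \<in> convex_normals D (g (z (\<rho> k)))"
        by (simp add: KN \<eta>_def divide_inverse)
      obtain \<xi> where \<xi>: "\<xi> 0 = z (\<rho> k)" "(\<xi> has_vector_derivative p (z (\<rho> k))) (at 0)"
        and \<xi>S: "\<forall>\<^sub>F s in nhds 0. \<forall>n\<in>S. n \<bullet> (g (\<xi> s) - g (z (\<rho> k))) = 0"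
        using good[of "r3 k"] unfolding \<rho>_def good_def by blast
      have \<xi>K: "\<forall>\<^sub>F s in nhds 0. \<forall>n\<in>convex_normals D (g (z (\<rho> k))). n \<bullet> (g (\<xi> s) - g (z (\<rho> k))) = 0"
        using \<xi>S by (rule eventually_mono) (use S(2) KN in blast)
      have "n (\<rho> k) \<in> regular_normal_cone (gph ?N)
          (z (\<rho> k), blinfun_adjoint (g' (z (\<rho> k))) (m (r3 k)))"
        using reg[of "\<rho> k"] by (simp add: zq m(2) \<rho>_def)
      from normal_orthogonal_to_two_sided_tangent[OF D g g'' feas line \<xi> \<xi>K this]
      show ?thesis by (simp add: \<zeta>_def)
    qed
    have \<zeta>: "\<zeta> \<longlonglongrightarrow> us"
    proof -
      \<comment> \<open>Dividing \<open>q - xs\<close> by \<open>t\<close> splits off the part due to the moving derivative; the rest is the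
        image of \<open>\<eta>\<close> under a fixed injective map, so \<open>\<eta>\<close> converges.\<close>
      have "(\<lambda>k. snd (d (\<rho> k)) - blinfun_adjoint ((g' (z (\<rho> k)) - g' x) /\<^sub>R t (\<rho> k)) (m (r3 k)))
          \<longlonglongrightarrow> us - blinfun_adjoint (g'' x u) l"
        by (intro tendsto_diff tendsto_blinfun_adjoint sub[OF dus] sub[OF g'v] mr)
      moreover have "snd (d (\<rho> k)) - blinfun_adjoint ((g' (z (\<rho> k)) - g' x) /\<^sub>R t (\<rho> k)) (m (r3 k))
          = blinfun_adjoint (g' x) (\<eta> k)" for k
      proof -
        have "blinfun_adjoint (g' (z (\<rho> k))) (m (r3 k)) = blinfun_adjoint (g' x) l + t (\<rho> k) *\<^sub>R snd (d (\<rho> k))"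
          using m(2)[of "r3 k"] by (simp add: \<rho>_def q_def l(3))
        then have "t (\<rho> k) *\<^sub>R snd (d (\<rho> k)) =
            blinfun_adjoint (g' (z (\<rho> k)) - g' x) (m (r3 k)) + blinfun_adjoint (g' x) (m (r3 k) - l)"
          by (simp add: blinfun_adjoint_simps algebra_simps)
        then have "snd (d (\<rho> k)) = (blinfun_adjoint (g' (z (\<rho> k)) - g' x) (m (r3 k)) +
            blinfun_adjoint (g' x) (m (r3 k) - l)) /\<^sub>R t (\<rho> k)"
          by (metis nz scaleR_scaleR left_inverse scaleR_one)
        then show ?thesis by (simp add: \<eta>_def blinfun_adjoint_simps scaleR_add_right scaleR_diff_right)
      qed
      ultimately have lim: "(\<lambda>k. blinfun_adjoint (g' x) (\<eta> k)) \<longlonglongrightarrow> us - blinfun_adjoint (g'' x u) l"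
        by simp
      have "\<forall>\<^sub>F k in sequentially. \<eta> k \<in> S"
        unfolding \<eta>_def
        by (intro always_eventually allI subspace_scale subspace_diff S(1) l(1) subsetD[OF S(2) m(1)])
      from blinfun_adjoint_multipliers_converge[OF S(1) inj tendsto_const this lim]
      obtain e where e: "\<eta> \<longlonglongrightarrow> e" "blinfun_adjoint (g' x) e = us - blinfun_adjoint (g'' x u) l"
        by blast
      have "\<zeta> \<longlonglongrightarrow> blinfun_adjoint (g'' x u) l + blinfun_adjoint (g' x) e"
        unfolding \<zeta>_def
        by (intro tendsto_add tendsto_blinfun_adjoint mr e blinfun.tendsto
            isCont_tendsto_compose[OF g'cont] isCont_tendsto_compose[OF g''cont]
            filterlim_compose[OF p] sub[OF zx])
      then show ?thesis by (simp add: e(2))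
    qed
    have "(\<lambda>k. n (\<rho> k) \<bullet> (p (z (\<rho> k)), \<zeta> k)) \<longlonglongrightarrow> (ws, - vs) \<bullet> (u, us)"
      by (intro tendsto_inner tendsto_Pair sub[OF n] filterlim_compose[OF p sub[OF zx]] \<zeta>)
    then have "(ws, - vs) \<bullet> (u, us) = 0" by (simp add: orth LIMSEQ_const_iff)
    then show ?thesis by (simp add: inner_commute)
  qed
  then show ?thesis
    by (auto simp: semismooth_star_in_direction_def gph_def directional_coderivative_def)
qed

theorem corollary5p3:
  fixes D :: "(real ^ 's) set"
    and g :: "real ^ 'n \<Rightarrow> real ^ 's"
    and \<Gamma> :: "(real ^ 'n) set"
    and xbar :: "real ^ 'n"
  assumes "polyhedron D"
    and "twice_continuously_differentiable g"
    and "\<Gamma> = {x. g x \<in> D}"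
    and "xbar \<in> \<Gamma>"
    and "metrically_subregular_at (\<lambda>x'. {g x' - d | d. d \<in> D}) xbar 0"
  shows "\<forall>\<^sub>F x in nhds xbar. \<forall>u.
    (\<forall>\<mu>. transpose (jacobian g (at x)) *v \<mu> = 0 \<and>
          \<mu> \<in> span (limiting_normal_cone (tangent_cone D (g x)) (jacobian g (at x) *v u))
          \<longrightarrow> \<mu> = 0) \<longrightarrow>
    (\<forall>xs us. semismooth_star_in_direction (limiting_normal_cone \<Gamma>) (x, xs) (u, us))"
proof -
  obtain g' :: "real ^ 'n \<Rightarrow> (real ^ 'n) \<Rightarrow>\<^sub>L (real ^ 's)"
    and g'' :: "real ^ 'n \<Rightarrow> (real ^ 'n) \<Rightarrow>\<^sub>L (real ^ 'n) \<Rightarrow>\<^sub>L (real ^ 's)"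
    where g: "\<And>x. (g has_derivative blinfun_apply (g' x)) (at x)"
      and g'': "\<And>x. (g' has_derivative blinfun_apply (g'' x)) (at x)"
      and cont: "continuous_on UNIV g''"
    using assms(2) unfolding twice_continuously_differentiable_def by blast
  have jac: "jacobian g (at x) *v h = g' x h" for x h
  proof -
    have "g differentiable at x" using g differentiable_def by blast
    then have "(g has_derivative (\<lambda>h. jacobian g (at x) *v h)) (at x)" by (simp add: jacobian_works)
    then have "(\<lambda>h. jacobian g (at x) *v h) = blinfun_apply (g' x)"
      using g has_derivative_unique by blast
    then show ?thesis by metis
  qed
  have adj: "transpose (jacobian g (at x)) *v \<mu> = blinfun_adjoint (g' x) \<mu>" for x \<mu>
  proof (rule vector_eq_ldot[THEN iffD1], intro allI)
    fix h
    show "h \<bullet> (transpose (jacobian g (at x)) *v \<mu>) = h \<bullet> blinfun_adjoint (g' x) \<mu>"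
      by (metis adjoint_matrix adjoint_works blinfun_adjoint_inner inner_commute jac
          matrix_vector_mul_linear)
  qed
  have inv: "{x'. 0 \<in> {g x' - d | d. d \<in> D}} = {x. g x \<in> D}" by auto
  have dist0: "infdist 0 {g x - d | d. d \<in> D} = infdist (g x) D" if "D \<noteq> {}" for x
  proof -
    have "{g x - d | d. d \<in> D} = (\<lambda>d. g x - d) ` D" by auto
    then show ?thesis using that by (simp add: infdist_def image_image dist_norm)
  qed
  have Dne: "D \<noteq> {}" using assms(3,4) by auto
  obtain \<kappa> where "\<forall>\<^sub>F x in nhds xbar. infdist x {x. g x \<in> D} \<le> \<kappa> * infdist (g x) D"
    using assms(5) unfolding metrically_subregular_at_def inv dist0[OF Dne] by (auto simp: Dne)
  then obtain U where U: "open U" "xbar \<in> U"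
    and err: "\<And>x. x \<in> U \<Longrightarrow> infdist x {x. g x \<in> D} \<le> \<kappa> * infdist (g x) D"
    unfolding eventually_nhds by blast
  have "\<forall>\<^sub>F x in nhds xbar. x \<in> U" using U by (rule eventually_nhds_in_open)
  then show ?thesis
  proof (rule eventually_mono, intro allI impI)
    fix x u xs us assume "x \<in> U"
      and nondeg: "\<forall>\<mu>. transpose (jacobian g (at x)) *v \<mu> = 0 \<and>
          \<mu> \<in> span (limiting_normal_cone (tangent_cone D (g x)) (jacobian g (at x) *v u))
          \<longrightarrow> \<mu> = 0"
    have inj: "\<mu> = 0" if "blinfun_adjoint (g' x) \<mu> = 0"
      "\<mu> \<in> span (limiting_normal_cone (tangent_cone D (g x)) (g' x u))" for \<mu>
      using nondeg that unfolding adj jac by blast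
    show "semismooth_star_in_direction (limiting_normal_cone \<Gamma>) (x, xs) (u, us)"
      unfolding assms(3)
      by (rule semismooth_star_constraint_normals[OF assms(1) g g'' cont U(1) \<open>x \<in> U\<close> err inj])
  qed
qed

end
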